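(* Consider a single-controller two-player zero-sum polynomial stochastic game with state space $\mathcal{S}=\{1,\dots,S\}$, action sets $A_1=A_2=[0,1]$, polynomial payoffs $r(s,a_1,a_2)$, polynomial transition probabilities $p(s';s,a_1)$ and discount factor $0\le\beta<1$, and the associated optimization problems $(P')$ and $(D')$ (all as defined in the context). Let $p^*$ be the optimal value of $(P')$ and $d^*$ the optimal value of $(D')$. Let $(\mathbf{v}^*,(\bar\nu^*(s))_{s\in\mathcal{S}})$ be an optimal solution of $(P')$ and $((\alpha^*(s))_{s\in\mathcal{S}},(\bar\xi^*(s))_{s\in\mathcal{S}})$ an optimal solution of $(D')$. For each $s$ let $\nu^*(s)$ and $\xi^*(s)$ be nonnegative measures supported on $A_2$ and $A_1$, respectively, having $\bar\nu^*(s)$ and $\bar\xi^*(s)$ as their moment sequences, and put $$\mu^*(s)=\frac{\xi^*(s)}{\int_{A_1}d\xi^*(s)},\qquad \mu^*=[\mu^*(1),\dots,\mu^*(S)],\quad \nu^*=[\nu^*(1),\dots,\nu^*(S)].$$ Then: 1. $p^*=d^*$. 2. $\mathbf{v}^*=\mathbf{v}_\beta(\mu^*,\nu^* )$. 3. $\mathbf{v}_\beta(\mu^*,\nu^* )$ satisfies the saddle-point inequality $$\mathbf{v}_\beta(\mu,\nu^* )\le \mathbf{v}_\beta(\mu^*,\nu^* )\le \mathbf{v}_\beta(\mu^*,\nu)$$ (componentwise in $\mathbb{R}^S$) for all mixed strategies $\mu,\nu$.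
   Context: Game. $\mathcal{S}=\{1,\dots,S\}$ is a finite state space; $A_1=A_2=[0,1]$ are the action sets of players 1 and 2. For each $s\in\mathcal{S}$ the payoff $r(s,a_1,a_2)=\sum_{i=0}^{d_s}\sum_{j=0}^{m_s}r_{ij}(s)a_1^ia_2^j$ (paid to player 1, the maximizer, by player 2, the minimizer) is a real polynomial. Single-controller assumption: the probability $p(s';s,a_1)$ of moving from $s$ to $s'$ depends only on $s,s'$ and the action $a_1$ of player 1; it is a polynomial in $a_1$ of degree at most $d_s$, with $p(s';s,a_1)\ge 0$ and $\sum_{s'}p(s';s,a_1)=1$ for all $a_1\in[0,1]$. The discount factor satisfies $0\le\beta<1$. Strategies. A mixed strategy for player 1 is a vector $\mu=[\mu(1),\dots,\mu(S)]$ of Borel probability measures on $A_1$; for player 2 a vector $\nu=[\nu(1),\dots,\nu(S)]$ of Borel probability measures on $A_2$. Put $P(\mu)_{ss'}=\int_{A_1}p(s';s,a_1)\,d\mu(s)(a_1)$, $r(s,\mu(s),\nu(s))=\int_{A_1}\int_{A_2}r(s,a_1,a_2)\,d\mu(s)\,d\nu(s)$, $\mathbf{r}(\mu,\nu)=[r(s,\mu(s),\nu(s))]_{s\in\mathcal{S}}\in\mathbb{R}^S$ and $\mathbf{v}_\beta(\mu,\nu)=(I-\beta P(\mu))^{-1}\mathbf{r}(\mu,\nu)\in\mathbb{R}^S$. Moments. For a measure $\lambda$ on $[0,1]$ the $i$-th moment is $\lambda_i=\int x^i\,d\lambda$. $\mathcal{M}(A)\subset\mathbb{R}^{n+1}$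 is the set of vectors $(\lambda_0,\dots,\lambda_n)$ of first $n+1$ moments of nonnegative measures supported on $A$ (length clear from context). $\mathcal{P}(A)$ is the set of univariate real polynomials nonnegative on $A$. Write $\bar\nu(s)=(\nu_0(s),\dots,\nu_{m_s}(s))$ and $\bar\xi(s)=(\xi_0(s),\dots,\xi_{d_s}(s))$. Problem $(P')$: minimize $\sum_{s=1}^S v(s)$ over $\mathbf{v}=(v(1),\dots,v(S))\in\mathbb{R}^S$ and vectors $\bar\nu(s)$, $s\in\mathcal{S}$, subject to, for all $s\in\mathcal{S}$: the polynomial in $a_1$ given by $v(s)-\sum_{i,j}r_{ij}(s)a_1^i\nu_j(s)-\beta\sum_{s'=1}^S p(s';s,a_1)v(s')$ belongs to $\mathcal{P}(A_1)$; $\bar\nu(s)\in\mathcal{M}(A_2)$; and $\nu_0(s)=1$. Problem $(D')$: maximize $\sum_{s=1}^S\alpha(s)$ over $\alpha(s)\in\mathbb{R}$ and vectors $\bar\xi(s)$, $s\in\mathcal{S}$, subject to: $\sum_{i,j}r_{ij}(s)\xi_i(s)a_2^j-\alpha(s)\ge 0$ for all $a_2\in A_2$, $s\in\mathcal{S}$; $\bar\xi(s)\in\mathcal{M}(A_1)$ for all $s\in\mathcal{S}$; and $\sum_{s}\int_{A_1}(\delta(s,s')-\beta p(s';s,a_1))\,d\xi(s)=1$ for all $s'\in\mathcal{S}$, where $\delta$ is the Kronecker delta, $\xi(s)$ is a measure with moments $\bar\xi(s)$, and the integral depends only on these moments. *)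

theory Defs
  imports "HOL-Probability.Probability" "HOL-Computational_Algebra.Polynomial"
begin

text \<open>
  The finite state space is the universe of a type \<open>'s :: finite\<close>.  A game is given by
  the degrees \<open>d s\<close> and \<open>m s\<close>, the payoff coefficients \<open>r s i j\<close>, the transition
  polynomials \<open>p s s'\<close> (the probability of moving from \<open>s\<close> to \<open>s'\<close>, as a
  polynomial in the action of player 1 alone) and the discount factor \<open>\<beta>\<close>.
\<close>

abbreviation (input) A1 :: "real set" where "A1 \<equiv> {0..1}"
abbreviation (input) A2 :: "real set" where "A2 \<equiv> {0..1}"

definition single_controller_game ::
  "('s::finite \<Rightarrow> nat) \<Rightarrow> ('s \<Rightarrow> 's \<Rightarrow> real poly) \<Rightarrow> real \<Rightarrow> bool" where
  "single_controller_game d p \<beta> \<longleftrightarrow>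
     (\<forall>s s'. degree (p s s') \<le> d s) \<and>
     (\<forall>s s'. \<forall>a\<in>A1. 0 \<le> poly (p s s') a) \<and>
     (\<forall>s. \<forall>a\<in>A1. (\<Sum>s'\<in>UNIV. poly (p s s') a) = 1) \<and>
     0 \<le> \<beta> \<and> \<beta> < 1"

definition payoff ::
  "('s \<Rightarrow> nat) \<Rightarrow> ('s \<Rightarrow> nat) \<Rightarrow> ('s \<Rightarrow> nat \<Rightarrow> nat \<Rightarrow> real) \<Rightarrow> 's \<Rightarrow> real \<Rightarrow> real \<Rightarrow> real" where
  "payoff d m r s a1 a2 = (\<Sum>i\<le>d s. \<Sum>j\<le>m s. r s i j * a1 ^ i * a2 ^ j)"

definition mixed_strategy :: "real set \<Rightarrow> ('s \<Rightarrow> real measure) \<Rightarrow> bool" where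
  "mixed_strategy A \<mu> \<longleftrightarrow>
     (\<forall>s. sets (\<mu> s) = sets (restrict_space borel A) \<and> prob_space (\<mu> s))"

definition trans_matrix ::
  "('s::finite \<Rightarrow> 's \<Rightarrow> real poly) \<Rightarrow> ('s \<Rightarrow> real measure) \<Rightarrow> real ^ 's ^ 's" where
  "trans_matrix p \<mu> = (\<chi> s s'. LINT a|\<mu> s. poly (p s s') a)"

definition payoff_vec ::
  "('s::finite \<Rightarrow> nat) \<Rightarrow> ('s \<Rightarrow> nat) \<Rightarrow> ('s \<Rightarrow> nat \<Rightarrow> nat \<Rightarrow> real) \<Rightarrow>
   ('s \<Rightarrow> real measure) \<Rightarrow> ('s \<Rightarrow> real measure) \<Rightarrow> real ^ 's" where
  "payoff_vec d m r \<mu> \<nu> = (\<chi> s. LINT a1|\<mu> s. LINT a2|\<nu> s. payoff d m r s a1 a2)"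

definition v_disc ::
  "('s::finite \<Rightarrow> nat) \<Rightarrow> ('s \<Rightarrow> nat) \<Rightarrow> ('s \<Rightarrow> nat \<Rightarrow> nat \<Rightarrow> real) \<Rightarrow>
   ('s \<Rightarrow> 's \<Rightarrow> real poly) \<Rightarrow> real \<Rightarrow>
   ('s \<Rightarrow> real measure) \<Rightarrow> ('s \<Rightarrow> real measure) \<Rightarrow> real ^ 's" where
  "v_disc d m r p \<beta> \<mu> \<nu> =
     matrix_inv (mat 1 - \<beta> *\<^sub>R trans_matrix p \<mu>) *v payoff_vec d m r \<mu> \<nu>"

definition moment :: "real measure \<Rightarrow> nat \<Rightarrow> real" where
  "moment M i = (LINT x|M. x ^ i)"

text \<open>
  A vector in \<open>\<real>\<^bsup>n+1\<^esup>\<close>, with \<open>n\<close> depending on the state, is a function on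
  \<open>{..n}\<close>, extended by \<open>undefined\<close>.  Finiteness and integrability ensure that the
  first \<open>n + 1\<close> moments exist; for compact \<open>A\<close> integrability is automatic.
\<close>

definition has_moment_vec :: "real set \<Rightarrow> nat \<Rightarrow> real measure \<Rightarrow> (nat \<Rightarrow> real) \<Rightarrow> bool" where
  "has_moment_vec A n M l \<longleftrightarrow>
     sets M = sets (restrict_space borel A) \<and> finite_measure M \<and>
     (\<forall>i\<le>n. integrable M (\<lambda>x. x ^ i)) \<and> l = restrict (moment M) {..n}"

definition moment_space :: "nat \<Rightarrow> real set \<Rightarrow> (nat \<Rightarrow> real) set" where
  "moment_space n A = {l. \<exists>M. has_moment_vec A n M l}"

definition nonneg_polys :: "real set \<Rightarrow> real poly set" where
  "nonneg_polys A = {q. \<forall>x\<in>A. 0 \<le> poly q x}"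

definition P_poly ::
  "('s::finite \<Rightarrow> nat) \<Rightarrow> ('s \<Rightarrow> nat) \<Rightarrow> ('s \<Rightarrow> nat \<Rightarrow> nat \<Rightarrow> real) \<Rightarrow>
   ('s \<Rightarrow> 's \<Rightarrow> real poly) \<Rightarrow> real \<Rightarrow> real ^ 's \<Rightarrow> ('s \<Rightarrow> nat \<Rightarrow> real) \<Rightarrow> 's \<Rightarrow> real poly" where
  "P_poly d m r p \<beta> v nb s =
     [:v $ s:] - (\<Sum>i\<le>d s. \<Sum>j\<le>m s. monom (r s i j * nb s j) i)
       - smult \<beta> (\<Sum>s'\<in>UNIV. smult (v $ s') (p s s'))"

lemma poly_P_poly:
  "poly (P_poly d m r p \<beta> v nb s) a =
     v $ s - (\<Sum>i\<le>d s. \<Sum>j\<le>m s. r s i j * a ^ i * nb s j)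
       - \<beta> * (\<Sum>s'\<in>UNIV. poly (p s s') a * v $ s')"
  by (simp add: P_poly_def poly_sum poly_monom mult_ac)

definition P_feasible ::
  "('s::finite \<Rightarrow> nat) \<Rightarrow> ('s \<Rightarrow> nat) \<Rightarrow> ('s \<Rightarrow> nat \<Rightarrow> nat \<Rightarrow> real) \<Rightarrow>
   ('s \<Rightarrow> 's \<Rightarrow> real poly) \<Rightarrow> real \<Rightarrow> ((real ^ 's) \<times> ('s \<Rightarrow> nat \<Rightarrow> real)) set" where
  "P_feasible d m r p \<beta> = {(v, nb). \<forall>s.
     P_poly d m r p \<beta> v nb s \<in> nonneg_polys A1 \<and>
     nb s \<in> moment_space (m s) A2 \<and>
     nb s 0 = 1}"

definition P_objective :: "(real ^ 's::finite) \<times> ('s \<Rightarrow> nat \<Rightarrow> real) \<Rightarrow> real" where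
  "P_objective = (\<lambda>(v, nb). \<Sum>s\<in>UNIV. v $ s)"

definition P_value ::
  "('s::finite \<Rightarrow> nat) \<Rightarrow> ('s \<Rightarrow> nat) \<Rightarrow> ('s \<Rightarrow> nat \<Rightarrow> nat \<Rightarrow> real) \<Rightarrow>
   ('s \<Rightarrow> 's \<Rightarrow> real poly) \<Rightarrow> real \<Rightarrow> ereal" where
  "P_value d m r p \<beta> = (INF x\<in>P_feasible d m r p \<beta>. ereal (P_objective x))"

definition P_optimal ::
  "('s::finite \<Rightarrow> nat) \<Rightarrow> ('s \<Rightarrow> nat) \<Rightarrow> ('s \<Rightarrow> nat \<Rightarrow> nat \<Rightarrow> real) \<Rightarrow>
   ('s \<Rightarrow> 's \<Rightarrow> real poly) \<Rightarrow> real \<Rightarrow> (real ^ 's) \<times> ('s \<Rightarrow> nat \<Rightarrow> real) \<Rightarrow> bool" where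
  "P_optimal d m r p \<beta> = is_arg_min P_objective (\<lambda>x. x \<in> P_feasible d m r p \<beta>)"

text \<open>
  In the last constraint the integrand is a polynomial of degree at most \<open>d s\<close>, so its
  value does not depend on the choice of the measures \<open>\<xi> s\<close> representing \<open>xb s\<close>.
\<close>

definition D_feasible ::
  "('s::finite \<Rightarrow> nat) \<Rightarrow> ('s \<Rightarrow> nat) \<Rightarrow> ('s \<Rightarrow> nat \<Rightarrow> nat \<Rightarrow> real) \<Rightarrow>
   ('s \<Rightarrow> 's \<Rightarrow> real poly) \<Rightarrow> real \<Rightarrow> ((real ^ 's) \<times> ('s \<Rightarrow> nat \<Rightarrow> real)) set" where
  "D_feasible d m r p \<beta> = {(\<alpha>, xb).
     (\<forall>s. \<forall>a2\<in>A2. 0 \<le> (\<Sum>i\<le>d s. \<Sum>j\<le>m s. r s i j * xb s i * a2 ^ j) - \<alpha> $ s) \<and>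
     (\<forall>s. xb s \<in> moment_space (d s) A1) \<and>
     (\<exists>\<xi>. (\<forall>s. has_moment_vec A1 (d s) (\<xi> s) (xb s)) \<and>
       (\<forall>s'. (\<Sum>s\<in>UNIV. LINT a|\<xi> s. (if s = s' then 1 else 0) - \<beta> * poly (p s s') a) = 1))}"

definition D_objective :: "(real ^ 's::finite) \<times> ('s \<Rightarrow> nat \<Rightarrow> real) \<Rightarrow> real" where
  "D_objective = (\<lambda>(\<alpha>, xb). \<Sum>s\<in>UNIV. \<alpha> $ s)"

definition D_value ::
  "('s::finite \<Rightarrow> nat) \<Rightarrow> ('s \<Rightarrow> nat) \<Rightarrow> ('s \<Rightarrow> nat \<Rightarrow> nat \<Rightarrow> real) \<Rightarrow>
   ('s \<Rightarrow> 's \<Rightarrow> real poly) \<Rightarrow> real \<Rightarrow> ereal" where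
  "D_value d m r p \<beta> = (SUP x\<in>D_feasible d m r p \<beta>. ereal (D_objective x))"

definition D_optimal ::
  "('s::finite \<Rightarrow> nat) \<Rightarrow> ('s \<Rightarrow> nat) \<Rightarrow> ('s \<Rightarrow> nat \<Rightarrow> nat \<Rightarrow> real) \<Rightarrow>
   ('s \<Rightarrow> 's \<Rightarrow> real poly) \<Rightarrow> real \<Rightarrow> (real ^ 's) \<times> ('s \<Rightarrow> nat \<Rightarrow> real) \<Rightarrow> bool" where
  "D_optimal d m r p \<beta> = is_arg_max D_objective (\<lambda>x. x \<in> D_feasible d m r p \<beta>)"

definition normalize_measure :: "real measure \<Rightarrow> real measure" where
  "normalize_measure M = scale_measure (1 / emeasure M (space M)) M"

end

theory Submission
  imports Defs
begin

text \<open>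
  Let \<open>\<xi>\<close> be a family of measures that satisfies the balance equations of \<open>D'\<close>: \<open>\<xi> s\<close> records the
  discounted frequency with which player 1 uses each action at \<open>s\<close>.  Since player 2 does not
  influence the transitions, the sum over all initial states of the discounted payoffs is
  \<open>f(\<xi>, \<nu>) = (\<Sum>s. \<integral>\<integral> r(s, a, b) d\<xi>(s) d\<nu>(s))\<close>, a bilinear function on two convex sets.  The
  problem \<open>D'\<close> maximises \<open>min\<^sub>\<nu> f(\<xi>, \<nu>)\<close> over \<open>\<xi>\<close>.  For fixed \<open>\<nu>\<close> player 1 faces a Markov decision
  process, whose linear programming dual is the minimisation of \<open>\<Sum> v\<close> in \<open>P'\<close>; so \<open>P'\<close> minimises
  \<open>max\<^sub>\<xi> f(\<xi>, \<nu>)\<close> over \<open>\<nu>\<close>.  Equality of the values is a minimax theorem for \<open>f\<close>.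

  Only the values are compared, so every step may lose a small \<open>\<epsilon>\<close>.  Player 2 is restricted
  to a finite net of actions, fine enough by uniform continuity of the payoff (\<open>payoff_net\<close>).  For a finite set of columns the minimax
  theorem is a theorem of the alternative, proved by induction from the separation theorem in the
  plane (\<open>convex_alternative\<close>).  Its two cases are turned into a feasible point of \<open>D'\<close>, by mixing
  the occupation measures of pure policies, or into a feasible point of \<open>P'\<close>, by the near duality for
  Markov decision processes (\<open>mdp_near_duality\<close>, \<open>duality_alternative\<close>).

  Weak duality sums, over the states, two inequalities between \<open>\<alpha> s\<close>, \<open>\<integral>\<integral> r d\<xi>(s) d\<nu>(s)\<close> and the
  integral of \<open>v s - \<beta> (\<Sum>t. p(t; s, a) v t)\<close> against \<open>\<xi>(s)\<close>.  At optimal solutions all of them are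
  equalities (\<open>complementary_slackness\<close>).  Division by the mass of \<open>\<xi> s\<close> shows that \<open>v\<close> solves the
  linear system that defines \<open>v\<^sub>\<beta>(\<mu>', \<nu>')\<close>.  The constraints of \<open>P'\<close> and \<open>D'\<close>, integrated against other
  strategies, say what happens to this system when one player deviates, and they yield the saddle
  point inequalities because \<open>I - \<beta> P\<close> has a nonnegative inverse (\<open>discounted_mono\<close>).
\<close>

section \<open>Discounted resolvents of stochastic matrices\<close>

definition stochastic_matrix :: "real ^ 's ^ 's \<Rightarrow> bool" where
  "stochastic_matrix P \<longleftrightarrow> (\<forall>s t. 0 \<le> P $ s $ t) \<and> (\<forall>s. (\<Sum>t\<in>UNIV. P $ s $ t) = 1)"

lemma discounted_mult_nth:
  fixes P :: "real ^ 's ^ 's::finite"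
  shows "((mat 1 - \<beta> *\<^sub>R P) *v x) $ s = x $ s - \<beta> * (\<Sum>t\<in>UNIV. P $ s $ t * x $ t)"
  by (simp add: matrix_vector_mult_diff_rdistrib scaleR_matrix_vector_assoc[symmetric])
    (simp add: matrix_vector_mult_def)

text \<open>
  A minimum principle: at a state where \<open>x\<close> is smallest, the average \<open>P x\<close> is at least
  \<open>x\<close>, so that \<open>x - \<beta> P x \<ge> 0\<close> forces \<open>(1 - \<beta>) x \<ge> 0\<close> there.
\<close>

lemma discounted_nonneg:
  fixes P :: "real ^ 's ^ 's::finite"
  assumes P: "stochastic_matrix P" and \<beta>: "0 \<le> \<beta>" "\<beta> < 1"
    and x: "0 \<le> (mat 1 - \<beta> *\<^sub>R P) *v x"
  shows "0 \<le> x"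
proof -
  obtain s0 where s0: "\<And>s. x $ s0 \<le> x $ s"
  proof -
    have "Min (range (($) x)) \<in> range (($) x)" by (intro Min_in) auto
    then obtain s0 where "x $ s0 = Min (range (($) x))" by (metis imageE)
    then show ?thesis using that[of s0] by simp
  qed
  have "x $ s0 = (\<Sum>t\<in>UNIV. P $ s0 $ t * x $ s0)"
    using P by (simp add: stochastic_matrix_def sum_distrib_right[symmetric])
  also have "\<dots> \<le> (\<Sum>t\<in>UNIV. P $ s0 $ t * x $ t)"
    using P s0 by (intro sum_mono mult_left_mono) (auto simp: stochastic_matrix_def)
  finally have "\<beta> * x $ s0 \<le> \<beta> * (\<Sum>t\<in>UNIV. P $ s0 $ t * x $ t)"
    using \<beta> by (intro mult_left_mono) auto
  moreover have "0 \<le> x $ s0 - \<beta> * (\<Sum>t\<in>UNIV. P $ s0 $ t * x $ t)"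
    using x unfolding less_eq_vec_def discounted_mult_nth by simp
  ultimately have "0 \<le> (1 - \<beta>) * x $ s0" by (simp add: algebra_simps)
  with \<beta> have "0 \<le> x $ s0" by (simp add: zero_le_mult_iff)
  with s0 show ?thesis unfolding less_eq_vec_def by (metis order_trans zero_index)
qed

lemma discounted_mono:
  fixes P :: "real ^ 's ^ 's::finite"
  assumes "stochastic_matrix P" "0 \<le> \<beta>" "\<beta> < 1"
    and "(mat 1 - \<beta> *\<^sub>R P) *v x \<le> (mat 1 - \<beta> *\<^sub>R P) *v y"
  shows "x \<le> y"
proof -
  have "0 \<le> (mat 1 - \<beta> *\<^sub>R P) *v (y - x)"
    using assms(4) by (simp only: matrix_vector_mult_diff_distrib diff_ge_0_iff_ge)
  then have "0 \<le> y - x" by (rule discounted_nonneg[OF assms(1-3)])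
  then show ?thesis by (simp only: diff_ge_0_iff_ge)
qed

lemma discounted_invertible:
  fixes P :: "real ^ 's ^ 's::finite"
  assumes "stochastic_matrix P" "0 \<le> \<beta>" "\<beta> < 1"
  shows "invertible (mat 1 - \<beta> *\<^sub>R P)"
proof -
  have "x = 0" if x: "(mat 1 - \<beta> *\<^sub>R P) *v x = 0" for x
  proof (rule order_antisym)
    show "x \<le> 0" "0 \<le> x"
      by (rule discounted_mono[OF assms], simp only: x matrix_vector_mult_0_right order_refl)+
  qed
  then show ?thesis
    unfolding invertible_left_inverse matrix_left_invertible_ker by blast
qed

lemma discounted_resolvent:
  fixes P :: "real ^ 's ^ 's::finite"
  assumes "stochastic_matrix P" "0 \<le> \<beta>" "\<beta> < 1"
  shows discounted_resolvent_right: "(mat 1 - \<beta> *\<^sub>R P) *v (matrix_inv (mat 1 - \<beta> *\<^sub>R P) *v c) = c"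
    and discounted_resolvent_left: "matrix_inv (mat 1 - \<beta> *\<^sub>R P) *v ((mat 1 - \<beta> *\<^sub>R P) *v x) = x"
proof -
  let ?M = "mat 1 - \<beta> *\<^sub>R P"
  have "?M ** matrix_inv ?M = mat 1 \<and> matrix_inv ?M ** ?M = mat 1"
    using someI_ex[OF discounted_invertible[OF assms, unfolded invertible_def]]
    unfolding matrix_inv_def .
  then show "?M *v (matrix_inv ?M *v c) = c" "matrix_inv ?M *v (?M *v x) = x"
    unfolding matrix_vector_mul_assoc by (simp_all only: matrix_vector_mul_lid)
qed

text \<open>
  The expected discounted number of visits to \<open>s\<close> when each state is once the initial state:
  the column sums of the resolvent, in other words the solution of \<open>x\<^sup>T (I - \<beta> P) = 1\<^sup>T\<close>.
\<close>

definition occupation :: "real \<Rightarrow> real ^ 's ^ 's \<Rightarrow> 's \<Rightarrow> real" where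
  "occupation \<beta> P s = (\<Sum>t\<in>UNIV. matrix_inv (mat 1 - \<beta> *\<^sub>R P) $ t $ s)"

lemma occupation_nonneg:
  fixes P :: "real ^ 's ^ 's::finite"
  assumes "stochastic_matrix P" "0 \<le> \<beta>" "\<beta> < 1"
  shows "0 \<le> occupation \<beta> P s"
proof -
  let ?B = "matrix_inv (mat 1 - \<beta> *\<^sub>R P)"
  have "0 \<le> ?B *v axis s 1"
    by (rule discounted_nonneg[OF assms])
      (simp only: discounted_resolvent_right[OF assms], simp add: less_eq_vec_def axis_def)
  then have "0 \<le> ?B $ t $ s" for t
    unfolding matrix_vector_mult_basis by (simp add: less_eq_vec_def column_def)
  then show ?thesis unfolding occupation_def by (intro sum_nonneg) auto
qed

text \<open>
  The total value over all initial states is thus the reward weighted by the occupation numbers.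
  This is what makes the total discounted payoff linear in the occupation of the states.
\<close>

lemma sum_resolvent:
  fixes P :: "real ^ 's ^ 's::finite"
  shows "(\<Sum>t\<in>UNIV. (matrix_inv (mat 1 - \<beta> *\<^sub>R P) *v c) $ t) = (\<Sum>s\<in>UNIV. occupation \<beta> P s * c $ s)"
  unfolding occupation_def matrix_vector_mult_def
  by (simp add: sum_distrib_right) (rule sum.swap)

lemma sum_occupation:
  fixes P :: "real ^ 's ^ 's::finite"
  assumes "stochastic_matrix P" "0 \<le> \<beta>" "\<beta> < 1"
  shows "(\<Sum>s\<in>UNIV. occupation \<beta> P s * (x $ s - \<beta> * (\<Sum>t\<in>UNIV. P $ s $ t * x $ t))) = (\<Sum>s\<in>UNIV. x $ s)"
  using sum_resolvent[of \<beta> P "(mat 1 - \<beta> *\<^sub>R P) *v x"]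
  unfolding discounted_resolvent_left[OF assms] discounted_mult_nth by (rule sym)

text \<open>
  The balance equations of \<open>D'\<close> for a pure policy, obtained by testing the preceding identity
  against a unit vector.
\<close>

lemma occupation_balance:
  fixes P :: "real ^ 's ^ 's::finite"
  assumes "stochastic_matrix P" "0 \<le> \<beta>" "\<beta> < 1"
  shows "(\<Sum>s\<in>UNIV. occupation \<beta> P s * ((if s = t then 1 else 0) - \<beta> * P $ s $ t)) = 1"
proof -
  have nth: "axis t (1::real) $ u = of_bool (u = t)" for u
    by (simp add: axis_def)
  have "(\<Sum>u\<in>UNIV. P $ s $ u * axis t 1 $ u) = P $ s $ t" for s
    unfolding nth by simp
  moreover have "(\<Sum>s\<in>UNIV. axis t (1::real) $ s) = 1"
    unfolding nth by simp
  ultimately show ?thesis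
    using sum_occupation[OF assms, of "axis t 1"] unfolding nth of_bool_def by simp
qed

lemma occupation_le:
  fixes P :: "real ^ 's ^ 's::finite"
  assumes "stochastic_matrix P" "0 \<le> \<beta>" "\<beta> < 1"
  shows "occupation \<beta> P s \<le> CARD('s) / (1 - \<beta>)"
proof -
  have "(\<Sum>t\<in>UNIV. P $ s $ t) = 1" for s
    using assms(1) unfolding stochastic_matrix_def by blast
  then have "(\<Sum>s\<in>UNIV. occupation \<beta> P s) * (1 - \<beta>) = CARD('s)"
    using sum_occupation[OF assms, of "\<chi> s. 1"] by (simp add: sum_distrib_right)
  then have "(\<Sum>s\<in>UNIV. occupation \<beta> P s) = CARD('s) / (1 - \<beta>)"
    using assms(3) by (simp add: field_simps)
  moreover have "occupation \<beta> P s \<le> (\<Sum>s\<in>UNIV. occupation \<beta> P s)"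
    using occupation_nonneg[OF assms] by (intro member_le_sum) auto
  ultimately show ?thesis by simp
qed


section \<open>Duality for Markov decision processes\<close>

text \<open>
  For a controller facing the rewards \<open>c s a\<close>, a stationary policy \<open>a\<close> is chosen whose total value
  is within \<open>\<eta>\<close> of the supremum.  If some action improved the Bellman inequality at a state by
  more than \<open>\<eta>\<close>, then changing the policy at that state alone would lower the value nowhere and
  raise it by more than \<open>\<eta>\<close> at that state.  Hence the value of \<open>a\<close> satisfies the Bellman inequalities up to
  \<open>\<eta>\<close>, and lifting it by \<open>\<eta> / (1 - \<beta>)\<close> makes them hold exactly.
\<close>

lemma mdp_near_duality:
  fixes P :: "'s::finite \<Rightarrow> 's \<Rightarrow> 'a \<Rightarrow> real" and c :: "'s \<Rightarrow> 'a \<Rightarrow> real"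
  assumes P: "\<And>a. (\<And>s. a s \<in> A) \<Longrightarrow> stochastic_matrix (\<chi> s t. P s t (a s))"
    and \<beta>: "0 \<le> \<beta>" "\<beta> < 1"
    and c: "\<And>s a. a \<in> A \<Longrightarrow> c s a \<le> C" and A: "A \<noteq> {}" and \<epsilon>: "0 < \<epsilon>"
  shows "\<exists>(v :: real ^ 's) a. (\<forall>s. a s \<in> A) \<and>
    (\<forall>s. \<forall>b\<in>A. c s b + \<beta> * (\<Sum>t\<in>UNIV. P s t b * v $ t) \<le> v $ s) \<and>
    (\<Sum>s\<in>UNIV. v $ s) \<le> (\<Sum>s\<in>UNIV. occupation \<beta> (\<chi> s t. P s t (a s)) s * c s (a s)) + \<epsilon>"
proof -
  define Q where "Q a = (\<chi> s t. P s t (a s))" for a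
  define Pol where "Pol = {a :: 's \<Rightarrow> 'a. \<forall>s. a s \<in> A}"
  define val where "val a = matrix_inv (mat 1 - \<beta> *\<^sub>R Q a) *v (\<chi> s. c s (a s))" for a
  define F where "F a = (\<Sum>s\<in>UNIV. val a $ s)" for a
  have Q: "stochastic_matrix (Q a)" if "a \<in> Pol" for a
    using P that by (simp add: Q_def Pol_def)
  have F: "F a = (\<Sum>s\<in>UNIV. occupation \<beta> (Q a) s * c s (a s))" for a
    unfolding F_def val_def sum_resolvent by simp
  have val: "val a $ s - \<beta> * (\<Sum>t\<in>UNIV. P s t (a s) * val a $ t) = c s (a s)" if "a \<in> Pol" for a s
    using discounted_resolvent_right[OF Q[OF that] \<beta>, of "\<chi> s. c s (a s)"]
    unfolding val_def[symmetric] vec_eq_iff discounted_mult_nth by (simp add: Q_def)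
  have "F a \<le> (\<Sum>s\<in>(UNIV::'s set). CARD('s) / (1 - \<beta>) * \<bar>C\<bar>)" if a: "a \<in> Pol" for a
    unfolding F
  proof (rule sum_mono)
    fix s
    have "occupation \<beta> (Q a) s * c s (a s) \<le> occupation \<beta> (Q a) s * \<bar>C\<bar>"
      using c[of "a s" s] a occupation_nonneg[OF Q[OF a] \<beta>, of s]
      by (intro mult_left_mono) (auto simp: Pol_def)
    also have "\<dots> \<le> CARD('s) / (1 - \<beta>) * \<bar>C\<bar>"
      using occupation_le[OF Q[OF a] \<beta>] by (intro mult_right_mono) auto
    finally show "occupation \<beta> (Q a) s * c s (a s) \<le> CARD('s) / (1 - \<beta>) * \<bar>C\<bar>" .
  qed
  then have bdd: "bdd_above (F ` Pol)" unfolding bdd_above_def by blast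
  have ne: "F ` Pol \<noteq> {}" using A by (auto simp: Pol_def)
  \<comment> \<open>The final lift adds \<open>\<eta> / (1 - \<beta>)\<close> at each state, hence \<open>\<epsilon>\<close> in total.\<close>
  define \<eta> where "\<eta> = \<epsilon> * (1 - \<beta>) / CARD('s)"
  have \<eta>: "0 < \<eta>" using \<epsilon> \<beta> by (simp add: \<eta>_def)
  obtain a where a: "a \<in> Pol" and Fa: "(SUP b\<in>Pol. F b) - \<eta> < F a"
  proof -
    have "(SUP b\<in>Pol. F b) - \<eta> < (SUP b\<in>Pol. F b)" using \<eta> by simp
    then show ?thesis using less_cSUP_iff[OF _ bdd] ne that by blast
  qed
  have bellman: "c s b + \<beta> * (\<Sum>t\<in>UNIV. P s t b * val a $ t) \<le> val a $ s + \<eta>" if b: "b \<in> A" for s b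
  proof (rule ccontr)
    assume "\<not> ?thesis"
    then have gain: "\<eta> < c s b + \<beta> * (\<Sum>t\<in>UNIV. P s t b * val a $ t) - val a $ s" by simp
    define a' where "a' = a(s := b)"
    have a': "a' \<in> Pol" using a b by (simp add: Pol_def a'_def)
    \<comment> \<open>The gain \<open>w\<close> satisfies the equation of the new policy with the Bellman surplus as reward.\<close>
    define w where "w = val a' - val a"
    have w: "w $ u - \<beta> * (\<Sum>t\<in>UNIV. P u t (a' u) * w $ t) =
        c u (a' u) + \<beta> * (\<Sum>t\<in>UNIV. P u t (a' u) * val a $ t) - val a $ u" for u
      using val[OF a', of u] by (simp add: w_def algebra_simps sum_subtractf)
    have "0 \<le> w $ u - \<beta> * (\<Sum>t\<in>UNIV. P u t (a' u) * w $ t)" for u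
      unfolding w using val[OF a, of u] gain \<eta> by (cases "u = s") (auto simp: a'_def)
    then have "0 \<le> (mat 1 - \<beta> *\<^sub>R Q a') *v w"
      unfolding less_eq_vec_def discounted_mult_nth by (simp add: Q_def)
    then have "0 \<le> w" by (rule discounted_nonneg[OF Q[OF a'] \<beta>])
    then have w0: "0 \<le> w $ u" for u by (simp add: less_eq_vec_def)
    have "0 \<le> \<beta> * (\<Sum>t\<in>UNIV. P s t (a' s) * w $ t)"
      using \<beta> w0 Q[OF a'] by (intro mult_nonneg_nonneg sum_nonneg) (auto simp: Q_def stochastic_matrix_def)
    with w[of s] gain have "\<eta> < w $ s" by (simp add: a'_def)
    also have "\<dots> \<le> (\<Sum>u\<in>UNIV. w $ u)" using w0 by (intro member_le_sum) auto
    also have "\<dots> = F a' - F a" by (simp add: F_def w_def sum_subtractf)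
    finally have "F a + \<eta> < F a'" by simp
    moreover have "F a' \<le> (SUP b\<in>Pol. F b)" using a' bdd by (rule cSUP_upper)
    ultimately show False using Fa by simp
  qed
  define v where "v = val a + (\<chi> s. \<eta> / (1 - \<beta>))"
  show ?thesis
  proof (intro exI conjI allI ballI)
    show "a s \<in> A" for s using a by (simp add: Pol_def)
    show "c s b + \<beta> * (\<Sum>t\<in>UNIV. P s t b * v $ t) \<le> v $ s" if b: "b \<in> A" for s b
    proof -
      have "(\<Sum>t\<in>UNIV. P s t b) = 1"
        using P[of "\<lambda>_. b"] b by (simp add: stochastic_matrix_def)
      then have "(\<Sum>t\<in>UNIV. P s t b * v $ t) = (\<Sum>t\<in>UNIV. P s t b * val a $ t) + \<eta> / (1 - \<beta>)"
        by (simp add: v_def distrib_left sum.distrib sum_distrib_right[symmetric]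
          sum_divide_distrib[symmetric])
      moreover have "\<beta> * (\<eta> / (1 - \<beta>)) + \<eta> = \<eta> / (1 - \<beta>)"
        using \<beta> by (simp add: field_simps)
      ultimately show ?thesis using bellman[OF b, of s] by (simp add: v_def distrib_left)
    qed
    show "(\<Sum>s\<in>UNIV. v $ s) \<le> (\<Sum>s\<in>UNIV. occupation \<beta> (\<chi> s t. P s t (a s)) s * c s (a s)) + \<epsilon>"
      using F[of a] \<beta> by (simp add: v_def sum.distrib F_def[symmetric] Q_def \<eta>_def)
  qed
qed


section \<open>A minimax alternative with one finite side\<close>

definition mix_pmf :: "real \<Rightarrow> 'a pmf \<Rightarrow> 'a pmf \<Rightarrow> 'a pmf" where
  "mix_pmf t p q = bernoulli_pmf t \<bind> (\<lambda>b. if b then p else q)"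

lemma set_mix_pmf_subset: "set_pmf (mix_pmf t p q) \<subseteq> set_pmf p \<union> set_pmf q"
  by (auto simp: mix_pmf_def split: if_splits)

lemma expectation_mix_pmf:
  fixes f :: "'a \<Rightarrow> real"
  assumes "finite (set_pmf p)" "finite (set_pmf q)" "0 \<le> t" "t \<le> 1"
  shows "measure_pmf.expectation (mix_pmf t p q) f =
    t * measure_pmf.expectation p f + (1 - t) * measure_pmf.expectation q f"
  unfolding mix_pmf_def
  by (subst pmf_expectation_bind[of UNIV]) (use assms in \<open>auto simp: UNIV_bool\<close>)

lemma planar_separation:
  fixes S :: "(real \<times> real) set"
  assumes S: "convex S" and no_pos: "\<And>x y. (x, y) \<in> S \<Longrightarrow> \<not> (0 < x \<and> 0 < y)"
  obtains t where "0 \<le> t" "t \<le> 1" "\<And>x y. (x, y) \<in> S \<Longrightarrow> t * x + (1 - t) * y \<le> 0"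
proof (cases "S = {}")
  case True
  then show ?thesis using that[of 0] by simp
next
  case False
  define T :: "(real \<times> real) set" where "T = {0<..} \<times> {0<..}"
  have "convex T" unfolding T_def by (intro convex_Times convex_real_interval)
  moreover have "T \<noteq> {}" "S \<inter> T = {}" using no_pos by (auto simp: T_def)
  ultimately obtain l b where l: "l \<noteq> 0" "\<And>z. z \<in> S \<Longrightarrow> inner l z \<le> b" "\<And>z. z \<in> T \<Longrightarrow> b \<le> inner l z"
    using separating_hyperplane_sets[OF S _ False] by metis
  obtain l1 l2 where l12: "l = (l1, l2)" by (cases l)
  have T: "b \<le> l1 * x + l2 * y" if "0 < x" "0 < y" for x y
    using l(3)[of "(x, y)"] that by (simp add: T_def l12)
  \<comment> \<open>The quadrant is a cone with apex 0, so the functional is nonnegative on it and the level is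
    at most 0.\<close>
  have b: "b \<le> 0"
  proof (rule ccontr)
    assume "\<not> b \<le> 0"
    define e where "e = b / (2 * (\<bar>l1 + l2\<bar> + 1))"
    have "0 < e" using \<open>\<not> b \<le> 0\<close> by (simp add: e_def add_nonneg_pos)
    then have "b \<le> e * (l1 + l2)" using T[of e e] by (simp add: algebra_simps)
    also have "\<dots> \<le> e * (\<bar>l1 + l2\<bar> + 1)" using \<open>0 < e\<close> by (intro mult_left_mono) auto
    also have "\<dots> = b / 2"
      unfolding e_def by (simp add: field_simps add_nonneg_eq_0_iff)
    finally show False using \<open>\<not> b \<le> 0\<close> by simp
  qed
  have pos: "0 \<le> k1" if k: "\<And>x. 0 < x \<Longrightarrow> b \<le> k1 * x + k2" for k1 k2
  proof (rule ccontr)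
    assume neg: "\<not> 0 \<le> k1"
    define x where "x = (\<bar>k2 - b\<bar> + 1) / - k1"
    have "0 < x" using neg by (simp add: x_def divide_pos_neg)
    moreover have "k1 * x = - \<bar>k2 - b\<bar> - 1" using neg by (simp add: x_def)
    ultimately show False using k[of x] by linarith
  qed
  have l1: "0 \<le> l1" using T[of _ 1] by (intro pos[of l1 l2]) auto
  have l2: "0 \<le> l2" using T[of 1] by (intro pos[of l2 l1]) (auto simp: add.commute)
  have sum_pos: "0 < l1 + l2" using l1 l2 l(1) l12 by (auto simp: zero_prod_def)
  show ?thesis
  proof (rule that[of "l1 / (l1 + l2)"])
    fix x y assume "(x, y) \<in> S"
    then have "l1 * x + l2 * y \<le> 0" using l(2)[of "(x, y)"] b by (simp add: l12)
    moreover have "1 - l1 / (l1 + l2) = l2 / (l1 + l2)"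
      using sum_pos by (simp add: field_simps)
    then have "l1 / (l1 + l2) * x + (1 - l1 / (l1 + l2)) * y = (l1 * x + l2 * y) / (l1 + l2)"
      by (simp add: add_divide_distrib)
    ultimately show "l1 / (l1 + l2) * x + (1 - l1 / (l1 + l2)) * y \<le> 0"
      using sum_pos by (simp add: divide_nonpos_pos)
  qed (use l1 l2 sum_pos in auto)
qed

text \<open>
  A theorem of the alternative in the style of Gordan, by induction on the number of coordinates.
  The members of \<open>U\<close> with positive coordinate \<open>k\<close> form a convex set none of whose members is positive
  on all remaining coordinates, so some average \<open>w\<close> of these coordinates is nonpositive on it.  Then
  sending \<open>u\<close> to the pair of its \<open>w\<close>-average and \<open>u k\<close> maps \<open>U\<close> to a convex set in the plane that
  misses the open positive quadrant, and a separating line tells how to mix \<open>w\<close> with the point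
  mass at \<open>k\<close>.
\<close>

lemma convex_alternative:
  fixes U :: "('k \<Rightarrow> real) set"
  assumes "finite K" "K \<noteq> {}"
    and "\<And>u v t. u \<in> U \<Longrightarrow> v \<in> U \<Longrightarrow> 0 \<le> t \<Longrightarrow> t \<le> 1 \<Longrightarrow> (\<lambda>k. t * u k + (1 - t) * v k) \<in> U"
    and "\<not> (\<exists>u\<in>U. \<forall>k\<in>K. 0 < u k)"
  shows "\<exists>w. set_pmf w \<subseteq> K \<and> (\<forall>u\<in>U. measure_pmf.expectation w u \<le> 0)"
  using assms
proof (induction K arbitrary: U rule: finite_ne_induct)
  case (singleton k)
  then show ?case by (intro exI[of _ "return_pmf k"]) (auto simp: not_less)
next
  case (insert k K)
  note convex_U = insert.prems(1)
  define U' where "U' = {u \<in> U. 0 < u k}"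
  have "\<exists>w. set_pmf w \<subseteq> K \<and> (\<forall>u\<in>U'. measure_pmf.expectation w u \<le> 0)"
  proof (rule insert.IH)
    show "(\<lambda>k. t * u k + (1 - t) * v k) \<in> U'" if "u \<in> U'" "v \<in> U'" "0 \<le> t" "t \<le> 1" for u v t
      using that convex_U[of u v t] convex_bound_lt[of "- u k" 0 "- v k" t "1 - t"]
      by (auto simp: U'_def)
    show "\<not> (\<exists>u\<in>U'. \<forall>k\<in>K. 0 < u k)" using insert.prems(2) by (auto simp: U'_def)
  qed
  then obtain w where w: "set_pmf w \<subseteq> K" "\<And>u. u \<in> U' \<Longrightarrow> measure_pmf.expectation w u \<le> 0" by blast
  have fin: "finite (set_pmf w)" using w(1) insert.hyps(1) by (rule finite_subset)
  define S where "S = (\<lambda>u. (measure_pmf.expectation w u, u k)) ` U"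
  have "convex S"
    unfolding convex_alt
  proof (intro ballI allI impI)
    fix z1 z2 and t :: real assume "z1 \<in> S" "z2 \<in> S" and t: "0 \<le> t \<and> t \<le> 1"
    then obtain u v where uv: "u \<in> U" "v \<in> U"
      "z1 = (measure_pmf.expectation w u, u k)" "z2 = (measure_pmf.expectation w v, v k)"
      by (auto simp: S_def)
    have "(\<lambda>k. t * v k + (1 - t) * u k) \<in> U" using uv t by (intro convex_U) auto
    moreover have "measure_pmf.expectation w (\<lambda>k. t * v k + (1 - t) * u k) =
        t * measure_pmf.expectation w v + (1 - t) * measure_pmf.expectation w u"
      by (simp add: integrable_measure_pmf_finite[OF fin])
    ultimately show "(1 - t) *\<^sub>R z1 + t *\<^sub>R z2 \<in> S"
      unfolding S_def uv by (force simp: algebra_simps)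
  qed
  moreover have "\<not> (0 < x \<and> 0 < y)" if "(x, y) \<in> S" for x y
    using that w(2) by (force simp: S_def U'_def)
  ultimately obtain t where t: "0 \<le> t" "t \<le> 1" "\<And>x y. (x, y) \<in> S \<Longrightarrow> t * x + (1 - t) * y \<le> 0"
    using planar_separation by blast
  show ?case
  proof (intro exI conjI ballI)
    show "set_pmf (mix_pmf t w (return_pmf k)) \<subseteq> insert k K"
      using set_mix_pmf_subset[of t w "return_pmf k"] w(1) by auto
    show "measure_pmf.expectation (mix_pmf t w (return_pmf k)) u \<le> 0" if "u \<in> U" for u
      using t(3)[of "measure_pmf.expectation w u" "u k"] that
      by (subst expectation_mix_pmf[OF fin _ t(1,2)]) (auto simp: S_def)
  qed
qed

text \<open>
  The minimax theorem for a game with arbitrary rows and finitely many columns, as an alternative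
  about the sign of its value.  Finitely supported row strategies suffice, since their payoff
  vectors already form a convex set.
\<close>

lemma minimax_alternative:
  fixes g :: "'x \<Rightarrow> 'k \<Rightarrow> real"
  assumes "finite K" "K \<noteq> {}"
  obtains (row) q where "finite (set_pmf q)" "set_pmf q \<subseteq> X"
      "\<And>k. k \<in> K \<Longrightarrow> 0 < measure_pmf.expectation q (\<lambda>x. g x k)"
    | (col) w where "set_pmf w \<subseteq> K" "\<And>x. x \<in> X \<Longrightarrow> measure_pmf.expectation w (g x) \<le> 0"
proof -
  define \<Q> where "\<Q> = {q. finite (set_pmf q) \<and> set_pmf q \<subseteq> X}"
  define val where "val q = (\<lambda>k. measure_pmf.expectation q (\<lambda>x. g x k))" for q
  have mix: "(\<lambda>k. t * val p k + (1 - t) * val q k) \<in> val ` \<Q>"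
    if "p \<in> \<Q>" "q \<in> \<Q>" "0 \<le> t" "t \<le> 1" for p q t
  proof (rule image_eqI[of _ _ "mix_pmf t p q"])
    show "(\<lambda>k. t * val p k + (1 - t) * val q k) = val (mix_pmf t p q)"
      using that by (simp add: val_def \<Q>_def expectation_mix_pmf)
    show "mix_pmf t p q \<in> \<Q>"
      using that finite_subset[OF set_mix_pmf_subset[of t p q]] set_mix_pmf_subset[of t p q]
      by (auto simp: \<Q>_def)
  qed
  show ?thesis
  proof (cases "\<exists>u\<in>val ` \<Q>. \<forall>k\<in>K. 0 < u k")
    case True
    then show ?thesis using row by (auto simp: \<Q>_def val_def)
  next
    case False
    obtain w where w: "set_pmf w \<subseteq> K" "\<And>u. u \<in> val ` \<Q> \<Longrightarrow> measure_pmf.expectation w u \<le> 0"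
      using convex_alternative[OF assms _ False] mix by blast
    have "g x \<in> val ` \<Q>" if "x \<in> X" for x
      using that by (intro image_eqI[of _ _ "return_pmf x"]) (auto simp: val_def \<Q>_def)
    with w col show ?thesis by blast
  qed
qed


section \<open>Moments of measures on the unit interval\<close>

lemma space_moment_vec:
  assumes "has_moment_vec A n M l"
  shows "space M = A"
proof -
  have "space M = space (restrict_space borel A)"
    using assms by (intro sets_eq_imp_space_eq) (simp add: has_moment_vec_def)
  then show ?thesis by (simp add: space_restrict_space)
qed

lemma integral_polynomial_moments:
  assumes "has_moment_vec A n M l"
  shows integrable_polynomial_moments: "integrable M (\<lambda>x. \<Sum>i\<le>n. c i * x ^ i)"
    and "(LINT x|M. (\<Sum>i\<le>n. c i * x ^ i)) = (\<Sum>i\<le>n. c i * l i)"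
proof -
  have int: "integrable M (\<lambda>x. x ^ i)" and l: "l i = moment M i" if "i \<le> n" for i
    using assms that by (auto simp: has_moment_vec_def)
  show "integrable M (\<lambda>x. \<Sum>i\<le>n. c i * x ^ i)"
    using int by (intro Bochner_Integration.integrable_sum integrable_mult_right) auto
  have "(LINT x|M. (\<Sum>i\<le>n. c i * x ^ i)) = (\<Sum>i\<le>n. LINT x|M. c i * x ^ i)"
    using int by (intro Bochner_Integration.integral_sum integrable_mult_right) auto
  also have "\<dots> = (\<Sum>i\<le>n. c i * l i)"
    using l by (intro sum.cong) (auto simp: moment_def)
  finally show "(LINT x|M. (\<Sum>i\<le>n. c i * x ^ i)) = (\<Sum>i\<le>n. c i * l i)" .
qed

lemma poly_eq_sum_degree_le:
  fixes q :: "real poly"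
  assumes "degree q \<le> n"
  shows "poly q x = (\<Sum>i\<le>n. coeff q i * x ^ i)"
  unfolding poly_altdef
  by (rule sum.mono_neutral_left) (use assms in \<open>auto simp: coeff_eq_0 not_le\<close>)

lemma integral_poly_moments:
  assumes "has_moment_vec A n M l" "degree q \<le> n"
  shows integrable_poly_moments: "integrable M (poly q)"
    and "(LINT x|M. poly q x) = (\<Sum>i\<le>n. coeff q i * l i)"
  using integral_polynomial_moments[OF assms(1), of "coeff q"]
  unfolding poly_eq_sum_degree_le[OF assms(2), symmetric] by auto

lemma moment_0: "moment M 0 = measure M (space M)"
  by (simp add: moment_def)

lemma moment_vec_0:
  assumes "has_moment_vec A n M l"
  shows "l 0 = measure M (space M)"
  using assms by (simp add: has_moment_vec_def moment_0)

lemma has_moment_vec_unit_interval: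
  assumes "finite_measure M" "sets M = sets (restrict_space borel {0..1})"
  shows "has_moment_vec {0..1} n M (restrict (moment M) {..n})"
proof -
  interpret finite_measure M by fact
  have sp: "space M = {0..1}"
    using sets_eq_imp_space_eq[OF assms(2)] by (simp add: space_restrict_space)
  have "integrable M (\<lambda>x. x ^ i)" for i
  proof (rule integrable_const_bound[of _ 1])
    show "AE x in M. norm (x ^ i) \<le> (1::real)"
      by (rule AE_I2) (simp add: sp power_le_one)
    show "(\<lambda>x::real. x ^ i) \<in> borel_measurable M"
      unfolding measurable_cong_sets[OF assms(2) refl]
      by (intro measurable_restrict_space1) measurable
  qed
  then show ?thesis using assms by (simp add: has_moment_vec_def)
qed

lemma normalize_measure_properties:
  fixes f :: "real \<Rightarrow> real"
  assumes fin: "finite_measure M" and pos: "0 < measure M (space M)"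
  shows sets_normalize_measure: "sets (normalize_measure M) = sets M"
    and prob_space_normalize_measure: "prob_space (normalize_measure M)"
    and integral_normalize_measure: "f \<in> borel_measurable M \<Longrightarrow>
      (LINT x|normalize_measure M. f x) = (LINT x|M. f x) / measure M (space M)"
proof -
  interpret finite_measure M by fact
  let ?c = "1 / measure M (space M)"
  have c: "1 / emeasure M (space M) = ennreal ?c"
    using divide_ennreal[of 1 "measure M (space M)"] pos by (simp add: emeasure_eq_measure)
  show "sets (normalize_measure M) = sets M" by (simp add: normalize_measure_def)
  have dens: "normalize_measure M = density M (\<lambda>_. ennreal ?c)"
    unfolding normalize_measure_def c
    by (rule measure_eqI) (simp_all add: emeasure_density_const)
  show "prob_space (normalize_measure M)"
  proof
    have "emeasure (normalize_measure M) (space (normalize_measure M)) =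
        ennreal ?c * ennreal (measure M (space M))"
      unfolding dens by (simp add: emeasure_density_const emeasure_eq_measure)
    also have "\<dots> = 1" using pos by (simp flip: ennreal_mult')
    finally show "emeasure (normalize_measure M) (space (normalize_measure M)) = 1" .
  qed
  show "(LINT x|normalize_measure M. f x) = (LINT x|M. f x) / measure M (space M)"
    if f: "f \<in> borel_measurable M"
    unfolding dens by (subst integral_density[OF f]) (use pos in auto)
qed

text \<open>
  The discrete measure that puts mass \<open>q x * h x\<close> at \<open>f x\<close>.  Off the support of \<open>q\<close>, where \<open>f\<close> may
  leave the unit interval, the functions are replaced by 0, so that the image measure lives on the
  unit interval.
\<close>

definition weighted_image :: "'x pmf \<Rightarrow> ('x \<Rightarrow> real) \<Rightarrow> ('x \<Rightarrow> real) \<Rightarrow> real measure" where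
  "weighted_image q h f =
    distr (density (measure_pmf q) (\<lambda>x. ennreal (if x \<in> set_pmf q then h x else 0)))
      (restrict_space borel {0..1}) (\<lambda>x. if x \<in> set_pmf q then f x else 0)"

lemma sets_weighted_image: "sets (weighted_image q h f) = sets (restrict_space borel {0..1})"
  by (simp add: weighted_image_def)

lemma weighted_image:
  fixes f h :: "'x \<Rightarrow> real"
  assumes fin: "finite (set_pmf q)"
    and f: "\<And>x. x \<in> set_pmf q \<Longrightarrow> f x \<in> {0..1}"
    and h: "\<And>x. x \<in> set_pmf q \<Longrightarrow> 0 \<le> h x"
  shows finite_measure_weighted_image: "finite_measure (weighted_image q h f)"
    and integral_weighted_image: "g \<in> borel_measurable borel \<Longrightarrow>
      (LINT a|weighted_image q h f. g a) = measure_pmf.expectation q (\<lambda>x. h x * g (f x) :: real)"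
proof -
  define f' where "f' x = (if x \<in> set_pmf q then f x else 0)" for x
  define h' where "h' x = (if x \<in> set_pmf q then h x else 0)" for x
  define N where "N = density (measure_pmf q) (\<lambda>x. ennreal (h' x))"
  have M: "weighted_image q h f = distr N (restrict_space borel {0..1}) f'"
    by (simp add: weighted_image_def N_def h'_def f'_def[abs_def])
  have h': "0 \<le> h' x" for x using h by (simp add: h'_def)
  have f': "f' \<in> measurable N (restrict_space borel {0..1})"
    by (rule measurable_restrict_space2) (use f in \<open>auto simp: f'_def N_def\<close>)
  have "emeasure N (space N) = (\<integral>\<^sup>+ x. ennreal (h' x) \<partial>measure_pmf q)"
    by (simp add: N_def emeasure_density)
  also have "\<dots> = ennreal (measure_pmf.expectation q h')"
    using h' by (intro nn_integral_eq_integral integrable_measure_pmf_finite[OF fin]) auto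
  finally have "finite_measure N" by (intro finite_measureI) simp
  then show "finite_measure (weighted_image q h f)"
    unfolding M by (rule finite_measure.finite_measure_distr[OF _ f'])
  assume g: "g \<in> borel_measurable borel"
  have "(LINT a|weighted_image q h f. g a) = (LINT x|N. g (f' x))"
    unfolding M by (rule integral_distr[OF f']) (rule measurable_restrict_space1[OF g])
  also have "\<dots> = measure_pmf.expectation q (\<lambda>x. h' x * g (f' x))"
    unfolding N_def by (subst integral_density) (use h' in auto)
  also have "\<dots> = measure_pmf.expectation q (\<lambda>x. h x * g (f x))"
    by (rule integral_cong_AE) (auto simp: AE_measure_pmf_iff f'_def h'_def)
  finally show "(LINT a|weighted_image q h f. g a) = measure_pmf.expectation q (\<lambda>x. h x * g (f x))" .
qed


section \<open>Weak duality in terms of moments\<close>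

text \<open>
  Payoff and transition probabilities are polynomials in the actions, so their integrals are linear
  in the moments.  These are the linear extensions from powers of an action to moment vectors.
\<close>

definition moment_payoff ::
  "('s \<Rightarrow> nat) \<Rightarrow> ('s \<Rightarrow> nat) \<Rightarrow> ('s \<Rightarrow> nat \<Rightarrow> nat \<Rightarrow> real) \<Rightarrow> 's \<Rightarrow> (nat \<Rightarrow> real) \<Rightarrow> (nat \<Rightarrow> real) \<Rightarrow> real" where
  "moment_payoff d m r s x y = (\<Sum>i\<le>d s. \<Sum>j\<le>m s. r s i j * x i * y j)"

definition moment_trans ::
  "('s \<Rightarrow> nat) \<Rightarrow> ('s \<Rightarrow> 's \<Rightarrow> real poly) \<Rightarrow> 's \<Rightarrow> 's \<Rightarrow> (nat \<Rightarrow> real) \<Rightarrow> real" where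
  "moment_trans d p s t x = (\<Sum>i\<le>d s. coeff (p s t) i * x i)"

lemma payoff_eq_moment_payoff: "payoff d m r s a b = moment_payoff d m r s (\<lambda>i. a ^ i) (\<lambda>j. b ^ j)"
  by (simp add: payoff_def moment_payoff_def)

lemma moment_payoff_rows:
  "moment_payoff d m r s x y = (\<Sum>i\<le>d s. (\<Sum>j\<le>m s. r s i j * y j) * x i)"
  by (simp add: moment_payoff_def sum_distrib_left sum_distrib_right mult_ac)

lemma moment_payoff_columns:
  "moment_payoff d m r s x y = (\<Sum>j\<le>m s. (\<Sum>i\<le>d s. r s i j * x i) * y j)"
  unfolding moment_payoff_def by (subst sum.swap) (simp add: sum_distrib_right)

lemma integral_moment_payoff_rows:
  assumes "has_moment_vec A (d s) M x"
  shows integrable_moment_payoff_rows: "integrable M (\<lambda>a. moment_payoff d m r s (\<lambda>i. a ^ i) y)"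
    and "(LINT a|M. moment_payoff d m r s (\<lambda>i. a ^ i) y) = moment_payoff d m r s x y"
  unfolding moment_payoff_rows by (rule integral_polynomial_moments[OF assms])+

lemma integral_moment_payoff_columns:
  assumes "has_moment_vec A (m s) M y"
  shows "(LINT b|M. moment_payoff d m r s x (\<lambda>j. b ^ j)) = moment_payoff d m r s x y"
  unfolding moment_payoff_columns by (rule integral_polynomial_moments[OF assms])

context
  fixes d m :: "'s::finite \<Rightarrow> nat" and r :: "'s \<Rightarrow> nat \<Rightarrow> nat \<Rightarrow> real"
    and p :: "'s \<Rightarrow> 's \<Rightarrow> real poly" and \<beta> :: real
  assumes game: "single_controller_game d p \<beta>"
begin

lemma discount: "0 \<le> \<beta>" "\<beta> < 1"
  using game by (auto simp: single_controller_game_def)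

lemma integral_trans:
  assumes "has_moment_vec A (d s) M x"
  shows integrable_trans: "integrable M (poly (p s t))"
    and "(LINT a|M. poly (p s t) a) = moment_trans d p s t x"
proof -
  have deg: "degree (p s t) \<le> d s" using game by (simp add: single_controller_game_def)
  show "integrable M (poly (p s t))" "(LINT a|M. poly (p s t) a) = moment_trans d p s t x"
    using integral_poly_moments[OF assms deg] by (simp_all add: moment_trans_def)
qed

lemma moment_trans_nonneg:
  assumes "x \<in> moment_space (d s) {0..1}"
  shows "0 \<le> moment_trans d p s t x"
proof -
  obtain M where M: "has_moment_vec {0..1} (d s) M x"
    using assms by (auto simp: moment_space_def)
  have "0 \<le> (LINT a|M. poly (p s t) a)"
    using game space_moment_vec[OF M]
    by (intro Bochner_Integration.integral_nonneg) (auto simp: single_controller_game_def)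
  then show ?thesis by (simp add: integral_trans[OF M])
qed

lemma sum_moment_trans:
  assumes "x \<in> moment_space (d s) {0..1}"
  shows "(\<Sum>t\<in>UNIV. moment_trans d p s t x) = x 0"
proof -
  obtain M where M: "has_moment_vec {0..1} (d s) M x"
    using assms by (auto simp: moment_space_def)
  have "(\<Sum>t\<in>UNIV. moment_trans d p s t x) = (LINT a|M. (\<Sum>t\<in>UNIV. poly (p s t) a))"
    using integral_trans[OF M] by simp
  also have "\<dots> = (LINT a|M. 1)"
    using game space_moment_vec[OF M]
    by (intro Bochner_Integration.integral_cong) (auto simp: single_controller_game_def)
  finally show ?thesis using moment_vec_0[OF M] by simp
qed

text \<open>
  Feasibility for \<open>P'\<close> is the Bellman inequality at each action; integration against a measure turns
  it into an inequality between moments.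
\<close>

lemma P_feasible_moment_ineq:
  assumes feas: "(v, nb) \<in> P_feasible d m r p \<beta>" and "x \<in> moment_space (d s) {0..1}"
  shows "moment_payoff d m r s x (nb s) \<le> v $ s * x 0 - \<beta> * (\<Sum>t\<in>UNIV. moment_trans d p s t x * v $ t)"
proof -
  obtain M where M: "has_moment_vec {0..1} (d s) M x"
    using assms(2) by (auto simp: moment_space_def)
  interpret finite_measure M using M by (simp add: has_moment_vec_def)
  have poly: "poly (P_poly d m r p \<beta> v nb s) a = v $ s - moment_payoff d m r s (\<lambda>i. a ^ i) (nb s)
      - \<beta> * (\<Sum>t\<in>UNIV. poly (p s t) a * v $ t)" for a
    by (simp add: poly_P_poly moment_payoff_def)
  have "0 \<le> (LINT a|M. poly (P_poly d m r p \<beta> v nb s) a)"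
    using feas space_moment_vec[OF M]
    by (intro Bochner_Integration.integral_nonneg) (auto simp: P_feasible_def nonneg_polys_def)
  also have "\<dots> = v $ s * x 0 - moment_payoff d m r s x (nb s)
      - \<beta> * (\<Sum>t\<in>UNIV. moment_trans d p s t x * v $ t)"
    unfolding poly
    using integral_moment_payoff_rows[where d = d and s = s and m = m and r = r and y = "nb s", OF M] integral_trans[OF M] moment_vec_0[OF M]
    by simp
  finally show ?thesis by simp
qed

lemma D_feasible_moment_ineq:
  assumes feas: "(\<alpha>, xb) \<in> D_feasible d m r p \<beta>" and "y \<in> moment_space (m s) {0..1}"
  shows "\<alpha> $ s * y 0 \<le> moment_payoff d m r s (xb s) y"
proof -
  obtain M where M: "has_moment_vec {0..1} (m s) M y"
    using assms(2) by (auto simp: moment_space_def)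
  interpret finite_measure M using M by (simp add: has_moment_vec_def)
  have int: "integrable M (\<lambda>b. moment_payoff d m r s (xb s) (\<lambda>j. b ^ j))"
    unfolding moment_payoff_columns by (rule integrable_polynomial_moments[OF M])
  have "\<alpha> $ s * y 0 = (LINT b|M. \<alpha> $ s)" by (simp add: moment_vec_0[OF M])
  also have "\<dots> \<le> (LINT b|M. moment_payoff d m r s (xb s) (\<lambda>j. b ^ j))"
    using feas space_moment_vec[OF M]
    by (intro integral_mono int) (auto simp: D_feasible_def moment_payoff_def)
  also have "\<dots> = moment_payoff d m r s (xb s) y" by (rule integral_moment_payoff_columns[where m = m and s = s, OF M])
  finally show ?thesis .
qed

lemma D_feasible_balance:
  assumes feas: "(\<alpha>, xb) \<in> D_feasible d m r p \<beta>"
  shows "(\<Sum>s\<in>UNIV. (if s = t then xb s 0 else 0) - \<beta> * moment_trans d p s t (xb s)) = 1"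
proof -
  obtain \<xi> where \<xi>: "\<And>s. has_moment_vec {0..1} (d s) (\<xi> s) (xb s)"
    and eq: "(\<Sum>s\<in>UNIV. LINT a|\<xi> s. (if s = t then 1 else 0) - \<beta> * poly (p s t) a) = 1"
    using feas by (simp add: D_feasible_def) blast
  have "(LINT a|\<xi> s. (if s = t then 1 else 0) - \<beta> * poly (p s t) a) =
      (if s = t then xb s 0 else 0) - \<beta> * moment_trans d p s t (xb s)" for s
  proof -
    interpret finite_measure "\<xi> s" using \<xi>[of s] by (simp add: has_moment_vec_def)
    show ?thesis using integral_trans[OF \<xi>, of s t] moment_vec_0[OF \<xi>, of s] by auto
  qed
  with eq show ?thesis by simp
qed

text \<open>
  The balance equations of \<open>D'\<close> are adjoint to the Bellman operator of \<open>P'\<close>: weighting them with \<open>v\<close>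
  and exchanging the sums moves the transitions from the measures to \<open>v\<close>.
\<close>

lemma D_feasible_sum:
  assumes feas: "(\<alpha>, xb) \<in> D_feasible d m r p \<beta>"
  shows "(\<Sum>s\<in>UNIV. v $ s * xb s 0 - \<beta> * (\<Sum>t\<in>UNIV. moment_trans d p s t (xb s) * v $ t)) =
    (\<Sum>t\<in>UNIV. v $ t)"
proof -
  have "(\<Sum>t\<in>UNIV. v $ t) =
      (\<Sum>t\<in>UNIV. v $ t * (\<Sum>s\<in>UNIV. (if s = t then xb s 0 else 0) - \<beta> * moment_trans d p s t (xb s)))"
    by (simp only: D_feasible_balance[OF feas] mult_1_right)
  also have "\<dots> = (\<Sum>s\<in>UNIV. \<Sum>t\<in>UNIV.
      v $ t * ((if s = t then xb s 0 else 0) - \<beta> * moment_trans d p s t (xb s)))"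
    unfolding sum_distrib_left by (rule sum.swap)
  also have "\<dots> = (\<Sum>s\<in>UNIV. \<Sum>t\<in>UNIV.
      (if s = t then v $ t * xb s 0 else 0) - \<beta> * (moment_trans d p s t (xb s) * v $ t))"
    by (intro sum.cong refl) (simp add: algebra_simps)
  also have "\<dots> = (\<Sum>s\<in>UNIV. v $ s * xb s 0 - \<beta> * (\<Sum>t\<in>UNIV. moment_trans d p s t (xb s) * v $ t))"
    by (simp add: sum_subtractf sum_distrib_left)
  finally show ?thesis by (rule sym)
qed

text \<open>
  Every state counts once as initial state and receives a nonnegative flow besides.
  Hence the division by the mass in the definition of \<open>\<mu>'\<close> is legitimate.
\<close>

lemma D_feasible_mass:
  assumes feas: "(\<alpha>, xb) \<in> D_feasible d m r p \<beta>"
  shows "1 \<le> xb t 0"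
proof -
  have "0 \<le> (\<Sum>s\<in>UNIV. \<beta> * moment_trans d p s t (xb s))"
    using feas discount by (intro sum_nonneg mult_nonneg_nonneg moment_trans_nonneg) (auto simp: D_feasible_def)
  then show ?thesis using D_feasible_balance[OF feas, of t] by (simp add: sum_subtractf)
qed

text \<open>
  Evaluating both families of inequalities at the moments of the other problem puts the payoff at
  each state between the contributions of that state to the two objectives.
\<close>

lemma P_feasible_between:
  assumes P: "(v, nb) \<in> P_feasible d m r p \<beta>" and D: "(\<alpha>, xb) \<in> D_feasible d m r p \<beta>"
  shows "\<alpha> $ s \<le> moment_payoff d m r s (xb s) (nb s)"
    and "moment_payoff d m r s (xb s) (nb s) \<le>
      v $ s * xb s 0 - \<beta> * (\<Sum>t\<in>UNIV. moment_trans d p s t (xb s) * v $ t)"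
  using D_feasible_moment_ineq[OF D, of "nb s" s] P_feasible_moment_ineq[OF P, of "xb s" s] P D
  by (auto simp: P_feasible_def D_feasible_def)

lemma weak_duality:
  assumes P: "(v, nb) \<in> P_feasible d m r p \<beta>" and D: "(\<alpha>, xb) \<in> D_feasible d m r p \<beta>"
  shows "(\<Sum>s\<in>UNIV. \<alpha> $ s) \<le> (\<Sum>s\<in>UNIV. v $ s)"
  unfolding D_feasible_sum[OF D, of v, symmetric]
  by (intro sum_mono order_trans[OF P_feasible_between[OF P D]])

lemma complementary_slackness:
  assumes P: "(v, nb) \<in> P_feasible d m r p \<beta>" and D: "(\<alpha>, xb) \<in> D_feasible d m r p \<beta>"
    and eq: "(\<Sum>s\<in>UNIV. v $ s) = (\<Sum>s\<in>UNIV. \<alpha> $ s)"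
  shows "\<alpha> $ s = moment_payoff d m r s (xb s) (nb s)"
    and "moment_payoff d m r s (xb s) (nb s) =
      v $ s * xb s 0 - \<beta> * (\<Sum>t\<in>UNIV. moment_trans d p s t (xb s) * v $ t)"
proof -
  define u where "u s = v $ s * xb s 0 - \<beta> * (\<Sum>t\<in>UNIV. moment_trans d p s t (xb s) * v $ t)" for s
  have le: "\<alpha> $ s \<le> u s" for s
    unfolding u_def using P_feasible_between[OF P D] by (rule order_trans)
  have "(\<Sum>s\<in>UNIV. u s - \<alpha> $ s) = 0"
    using eq D_feasible_sum[OF D, of v] by (simp add: sum_subtractf u_def)
  then have "u s - \<alpha> $ s = 0"
    using le by (subst (asm) sum_nonneg_eq_0_iff) auto
  then show "\<alpha> $ s = moment_payoff d m r s (xb s) (nb s)"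
    and "moment_payoff d m r s (xb s) (nb s) =
      v $ s * xb s 0 - \<beta> * (\<Sum>t\<in>UNIV. moment_trans d p s t (xb s) * v $ t)"
    using P_feasible_between[OF P D, of s] by (simp_all add: u_def)
qed

end


section \<open>Strong duality\<close>

text \<open>
  A net that replaces an action of player 2 uniformly in the action of player 1; only this
  uniformity makes the error survive averaging over the actions of player 1.
\<close>

lemma payoff_net:
  fixes d m :: "'s::finite \<Rightarrow> nat"
  assumes "0 < \<eta>"
  obtains G where "finite G" "G \<noteq> {}" "G \<subseteq> {0..1}"
    "\<forall>s. \<forall>y\<in>{0..1}. \<exists>g\<in>G. \<forall>a\<in>{0..1}. payoff d m r s a g \<le> payoff d m r s a y + \<eta>"
proof -
  have "\<exists>G. finite G \<and> G \<subseteq> {0..1} \<and>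
      (\<forall>y\<in>{0..1}. \<exists>g\<in>G. \<forall>a\<in>{0..1}. payoff d m r s a g \<le> payoff d m r s a y + \<eta>)" for s
  proof -
    have "continuous_on ({0..1} \<times> {0..1}) (\<lambda>z. payoff d m r s (fst z) (snd z))"
      unfolding payoff_def by (intro continuous_intros)
    then have "uniformly_continuous_on ({0..1} \<times> {0..1}) (\<lambda>z. payoff d m r s (fst z) (snd z))"
      by (intro compact_uniformly_continuous compact_Times compact_Icc)
    then have "\<exists>\<delta>>0. \<forall>z\<in>{0..1} \<times> {0..1}. \<forall>z'\<in>{0..1} \<times> {0..1}. dist z' z < \<delta> \<longrightarrow>
        dist (payoff d m r s (fst z') (snd z')) (payoff d m r s (fst z) (snd z)) < \<eta>"
      unfolding uniformly_continuous_on_def using assms by simp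
    then obtain \<delta> where \<delta>: "0 < \<delta>" and close: "\<forall>z\<in>{0..1} \<times> {0..1}. \<forall>z'\<in>{0..1} \<times> {0..1}. dist z' z < \<delta> \<longrightarrow>
        dist (payoff d m r s (fst z') (snd z')) (payoff d m r s (fst z) (snd z)) < \<eta>"
      by (elim exE conjE)
    obtain G where G: "finite G" "G \<subseteq> {0..1::real}" "{0..1} \<subseteq> (\<Union>g\<in>G. ball g \<delta>)"
      using seq_compact_imp_totally_bounded[OF compact_imp_seq_compact[OF compact_Icc]] \<delta>
      by metis
    have "\<exists>g\<in>G. \<forall>a\<in>{0..1}. payoff d m r s a g \<le> payoff d m r s a y + \<eta>" if y: "y \<in> {0..1}" for y
    proof -
      obtain g where g: "g \<in> G" "dist g y < \<delta>" using G(3) y by auto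
      have "payoff d m r s a g \<le> payoff d m r s a y + \<eta>" if "a \<in> {0..1}" for a
        using bspec[OF bspec[OF close, of "(a, y)"], of "(a, g)"] g G(2) y that
        by (auto simp: dist_Pair_Pair dist_real_def)
      with g show ?thesis by blast
    qed
    with G show ?thesis by blast
  qed
  then obtain G where G: "\<And>s. finite (G s)" "\<And>s. G s \<subseteq> {0..1}"
    "\<And>s y. y \<in> {0..1} \<Longrightarrow> \<exists>g\<in>G s. \<forall>a\<in>{0..1}. payoff d m r s a g \<le> payoff d m r s a y + \<eta>"
    by metis
  show ?thesis
  proof (rule that[of "\<Union>s. G s"])
    show "finite (\<Union>s. G s)" using G(1) by simp
    show "(\<Union>s. G s) \<noteq> {}" using G(3)[of 0 undefined] by auto
    show "(\<Union>s. G s) \<subseteq> {0..1}" using G(2) by blast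
    show "\<forall>s. \<forall>y\<in>{0..1}. \<exists>g\<in>\<Union>s. G s. \<forall>a\<in>{0..1}.
        payoff d m r s a g \<le> payoff d m r s a y + \<eta>"
      using G(3) by (meson UNIV_I UN_I)
  qed
qed

lemma measurable_payoff_row: "(\<lambda>a. payoff d m r s a b) \<in> borel_measurable borel"
  unfolding payoff_def by measurable

lemma measurable_payoff_column: "payoff d m r s a \<in> borel_measurable borel"
  unfolding payoff_def by measurable

lemma measurable_poly_real: "poly (q :: real poly) \<in> borel_measurable borel"
  by (intro borel_measurable_continuous_onI continuous_intros)

lemma moment_payoff_bound:
  assumes "\<And>i. \<bar>x i\<bar> \<le> 1"
  shows "moment_payoff d m r s x y \<le> (\<Sum>i\<le>d s. \<Sum>j\<le>m s. \<bar>r s i j\<bar> * \<bar>y j\<bar>)"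
  unfolding moment_payoff_def
proof (intro sum_mono)
  fix i j
  have "r s i j * x i * y j \<le> \<bar>r s i j\<bar> * \<bar>x i\<bar> * \<bar>y j\<bar>"
    by (metis abs_ge_self abs_mult)
  also have "\<dots> \<le> \<bar>r s i j\<bar> * 1 * \<bar>y j\<bar>"
    using assms by (intro mult_right_mono mult_left_mono) auto
  finally show "r s i j * x i * y j \<le> \<bar>r s i j\<bar> * \<bar>y j\<bar>" by simp
qed

context
  fixes d m :: "'s::finite \<Rightarrow> nat" and r :: "'s \<Rightarrow> nat \<Rightarrow> nat \<Rightarrow> real"
    and p :: "'s \<Rightarrow> 's \<Rightarrow> real poly" and \<beta> :: real
  assumes game: "single_controller_game d p \<beta>"
begin

lemma stochastic_pure:
  assumes "\<And>s. a s \<in> {0..1}"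
  shows "stochastic_matrix (\<chi> s t. poly (p s t) (a s))"
  using game assms unfolding stochastic_matrix_def single_controller_game_def by simp

text \<open>
  The rows of the auxiliary game are the pure policies \<open>a\<close> of player 1, its columns the policies \<open>\<sigma>\<close>
  of player 2 with actions in a finite net, and the payoff is the total discounted payoff minus \<open>c\<close>.

  If a mixture \<open>q\<close> of rows has positive payoff against all columns, its averaged occupation measures
  are balanced, and the minimal payoff at each state, corrected by the error of the net, is
  admissible as \<open>\<alpha>\<close>.  These minima can be attained by one column at all states at once, so their
  sum exceeds \<open>c\<close>.  Otherwise a mixture \<open>w\<close> of columns has nonpositive payoff against all rows;
  its marginals form the strategy of player 2 in \<open>P'\<close>, and the decision process that it leaves
  to player 1 supplies \<open>v\<close>.
\<close>

lemma duality_alternative: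
  assumes \<epsilon>: "0 < \<epsilon>"
  shows "(\<exists>x\<in>P_feasible d m r p \<beta>. P_objective x \<le> c + \<epsilon>) \<or>
    (\<exists>y\<in>D_feasible d m r p \<beta>. c - \<epsilon> \<le> D_objective y)"
proof -
  note \<beta> = discount[OF game]
  define B where "B = CARD('s) / (1 - \<beta>)"
  have B: "0 < B" using \<beta> by (simp add: B_def)
  \<comment> \<open>The mass at each state is at most \<open>B\<close>, so the net costs at most \<open>B * \<eta>\<close> at each state.\<close>
  define \<eta> where "\<eta> = \<epsilon> / (CARD('s) * B)"
  have \<eta>: "0 < \<eta>" using \<epsilon> B by (simp add: \<eta>_def)
  obtain G where G: "finite G" "G \<noteq> {}" "G \<subseteq> {0..1}" and net:
    "\<forall>s. \<forall>y\<in>{0..1}. \<exists>g\<in>G. \<forall>a\<in>{0..1}. payoff d m r s a g \<le> payoff d m r s a y + \<eta>"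
    by (rule payoff_net[OF \<eta>, of d m r]) (rule that)
  define occ where "occ a s = occupation \<beta> (\<chi> s t. poly (p s t) (a s)) s" for a s
  define A where "A = {a :: 's \<Rightarrow> real. \<forall>s. a s \<in> {0..1}}"
  define K where "K = (UNIV :: 's set) \<rightarrow>\<^sub>E G"
  have stoch: "stochastic_matrix (\<chi> s t. poly (p s t) (a s))" if "a \<in> A" for a
    using that by (intro stochastic_pure) (simp add: A_def)
  have occ0: "0 \<le> occ a s" and occB: "occ a s \<le> B" if "a \<in> A" for a s
    unfolding occ_def B_def
    by (rule occupation_nonneg[OF stoch[OF that] \<beta>], rule occupation_le[OF stoch[OF that] \<beta>])
  have K: "finite K" "K \<noteq> {}" using G by (auto simp: K_def PiE_eq_empty_iff intro: finite_PiE)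
  define g where "g a \<sigma> = (\<Sum>s\<in>UNIV. occ a s * payoff d m r s (a s) (\<sigma> s)) - c" for a \<sigma>
  consider (row) q where "finite (set_pmf q)" "set_pmf q \<subseteq> A"
      "\<And>\<sigma>. \<sigma> \<in> K \<Longrightarrow> 0 < measure_pmf.expectation q (\<lambda>a. g a \<sigma>)"
    | (col) w where "set_pmf w \<subseteq> K" "\<And>a. a \<in> A \<Longrightarrow> measure_pmf.expectation w (g a) \<le> 0"
    using minimax_alternative[OF K, of A g] by metis
  then show ?thesis
  proof cases
    case row
    note intq = integrable_measure_pmf_finite[OF row(1)]
    have qA: "a s \<in> {0..1}" "0 \<le> occ a s" "occ a s \<le> B" if "a \<in> set_pmf q" for a s
      using that row(2) occ0 occB by (auto simp: A_def)
    define \<xi> where "\<xi> s = weighted_image q (\<lambda>a. occ a s) (\<lambda>a. a s)" for s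
    have int: "(LINT b|\<xi> s. f b) = measure_pmf.expectation q (\<lambda>a. occ a s * f (a s))"
      if "f \<in> borel_measurable borel" for s and f :: "real \<Rightarrow> real"
      unfolding \<xi>_def by (rule integral_weighted_image[OF row(1) _ _ that]) (fact qA)+
    define xb where "xb s = restrict (moment (\<xi> s)) {..d s}" for s
    have xb: "has_moment_vec {0..1} (d s) (\<xi> s) (xb s)" for s
      unfolding xb_def \<xi>_def
      by (intro has_moment_vec_unit_interval sets_weighted_image
        finite_measure_weighted_image[OF row(1)] qA)
    define R where "R s y = measure_pmf.expectation q (\<lambda>a. occ a s * payoff d m r s (a s) y)" for s y
    have R: "R s y = moment_payoff d m r s (xb s) (\<lambda>j. y ^ j)" for s y
      using int[OF measurable_payoff_row, of s d m r s y]
        integral_moment_payoff_rows(2)[where d = d and s = s and m = m and r = r, OF xb]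
      by (simp add: R_def payoff_eq_moment_payoff)
    \<comment> \<open>Player 2 answers with the best point of the net at each state; by the choice of the net
      no other action is better by more than \<open>B * \<eta>\<close>.\<close>
    define \<sigma> where "\<sigma> s = (SOME y. y \<in> G \<and> (\<forall>z\<in>G. R s y \<le> R s z))" for s
    have \<sigma>: "\<sigma> s \<in> G" "\<And>z. z \<in> G \<Longrightarrow> R s (\<sigma> s) \<le> R s z" for s
    proof -
      have "Min (R s ` G) \<in> R s ` G" using G by (intro Min_in) auto
      then obtain y where "y \<in> G" "R s y = Min (R s ` G)" by auto
      then have "\<exists>y. y \<in> G \<and> (\<forall>z\<in>G. R s y \<le> R s z)" using G(1) by auto
      from someI_ex[OF this] show "\<sigma> s \<in> G" "\<And>z. z \<in> G \<Longrightarrow> R s (\<sigma> s) \<le> R s z"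
        unfolding \<sigma>_def by blast+
    qed
    have lower: "R s (\<sigma> s) - B * \<eta> \<le> R s y" if y: "y \<in> {0..1}" for s y
    proof -
      obtain z where z: "z \<in> G" "\<And>a. a \<in> {0..1} \<Longrightarrow> payoff d m r s a z \<le> payoff d m r s a y + \<eta>"
        using bspec[OF spec[OF net] y] by blast
      have "R s z \<le> measure_pmf.expectation q (\<lambda>a. occ a s * payoff d m r s (a s) y + B * \<eta>)"
        unfolding R_def
      proof (intro integral_mono_AE intq AE_pmfI)
        fix a assume a: "a \<in> set_pmf q"
        have "occ a s * payoff d m r s (a s) z \<le> occ a s * (payoff d m r s (a s) y + \<eta>)"
          using z(2) qA[OF a] by (intro mult_left_mono) auto
        also have "\<dots> \<le> occ a s * payoff d m r s (a s) y + B * \<eta>"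
          using qA[OF a] \<eta> by (simp add: distrib_left mult_right_mono)
        finally show "occ a s * payoff d m r s (a s) z \<le> occ a s * payoff d m r s (a s) y + B * \<eta>" .
      qed
      also have "\<dots> = R s y + B * \<eta>" by (simp add: R_def intq)
      finally show ?thesis using \<sigma>(2)[OF z(1), of s] by simp
    qed
    define \<alpha> :: "real ^ 's" where "\<alpha> = (\<chi> s. R s (\<sigma> s) - B * \<eta>)"
    have "(\<Sum>s\<in>UNIV. LINT b|\<xi> s. (if s = t then 1 else 0) - \<beta> * poly (p s t) b) = 1" for t
    proof -
      have "(\<Sum>s\<in>UNIV. LINT b|\<xi> s. (if s = t then 1 else 0) - \<beta> * poly (p s t) b) =
          (\<Sum>s\<in>UNIV. measure_pmf.expectation q
            (\<lambda>a. occ a s * ((if s = t then 1 else 0) - \<beta> * poly (p s t) (a s))))"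
        using measurable_poly_real by (intro sum.cong int) auto
      also have "\<dots> = measure_pmf.expectation q
          (\<lambda>a. \<Sum>s\<in>UNIV. occ a s * ((if s = t then 1 else 0) - \<beta> * poly (p s t) (a s)))"
        by (rule Bochner_Integration.integral_sum[symmetric]) (rule intq)
      also have "\<dots> = measure_pmf.expectation q (\<lambda>a. 1)"
      proof (intro integral_cong_AE AE_pmfI)
        fix a assume "a \<in> set_pmf q"
        then have "a \<in> A" using row(2) by blast
        from occupation_balance[OF stoch[OF this] \<beta>, of t]
        show "(\<Sum>s\<in>UNIV. occ a s * ((if s = t then 1 else 0) - \<beta> * poly (p s t) (a s))) = 1"
          by (simp add: occ_def)
      qed simp_all
      finally show ?thesis by simp
    qed
    then have "(\<alpha>, xb) \<in> D_feasible d m r p \<beta>"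
      using xb lower unfolding D_feasible_def moment_space_def
      by (auto simp: \<alpha>_def R moment_payoff_def)
    moreover have "c - \<epsilon> \<le> D_objective (\<alpha>, xb)"
    proof -
      have "\<sigma> \<in> K" using \<sigma>(1) by (simp add: K_def PiE_iff)
      then have "0 < measure_pmf.expectation q (\<lambda>a. g a \<sigma>)" by (rule row(3))
      also have "\<dots> = (\<Sum>s\<in>UNIV. R s (\<sigma> s)) - c" by (simp add: g_def R_def intq)
      finally show ?thesis using B by (simp add: D_objective_def \<alpha>_def sum_subtractf \<eta>_def)
    qed
    ultimately show ?thesis by blast
  next
    case col
    have fin: "finite (set_pmf w)" using col(1) K(1) by (rule finite_subset)
    note intw = integrable_measure_pmf_finite[OF fin]
    have w: "\<sigma> s \<in> {0..1}" if "\<sigma> \<in> set_pmf w" for \<sigma> s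
      using that col(1) G(3) PiE_mem[of \<sigma> UNIV "\<lambda>_. G" s] unfolding K_def by blast
    define \<nu> where "\<nu> s = weighted_image w (\<lambda>_. 1) (\<lambda>\<sigma>. \<sigma> s)" for s
    have int: "(LINT b|\<nu> s. f b) = measure_pmf.expectation w (\<lambda>\<sigma>. f (\<sigma> s))"
      if "f \<in> borel_measurable borel" for s and f :: "real \<Rightarrow> real"
    proof -
      have "(LINT b|\<nu> s. f b) = measure_pmf.expectation w (\<lambda>\<sigma>. 1 * f (\<sigma> s))"
        unfolding \<nu>_def by (rule integral_weighted_image[OF fin _ _ that]) (use w in auto)
      then show ?thesis by simp
    qed
    define nb where "nb s = restrict (moment (\<nu> s)) {..m s}" for s
    have nb: "has_moment_vec {0..1} (m s) (\<nu> s) (nb s)" for s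
      unfolding nb_def \<nu>_def
      by (intro has_moment_vec_unit_interval sets_weighted_image
        finite_measure_weighted_image[OF fin] w zero_le_one)
    have nb0: "nb s 0 = 1" for s
      using int[of "\<lambda>_. 1" s] by (simp add: moment_vec_0[OF nb])
    define h where "h s b = moment_payoff d m r s (\<lambda>i. b ^ i) (nb s)" for s and b :: real
    have h: "h s b = measure_pmf.expectation w (\<lambda>\<sigma>. payoff d m r s b (\<sigma> s))" for s b
      using int[OF measurable_payoff_column, of s d m r s b]
        integral_moment_payoff_columns[where m = m and s = s and d = d and r = r, OF nb]
      by (simp add: h_def payoff_eq_moment_payoff)
    define C where "C = (\<Sum>s\<in>UNIV. \<Sum>i\<le>d s. \<Sum>j\<le>m s. \<bar>r s i j\<bar> * \<bar>nb s j\<bar>)"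
    have hC: "h s b \<le> C" if "b \<in> {0..1}" for s b
    proof -
      have "h s b \<le> (\<Sum>i\<le>d s. \<Sum>j\<le>m s. \<bar>r s i j\<bar> * \<bar>nb s j\<bar>)"
        unfolding h_def using that by (intro moment_payoff_bound) (simp add: power_abs power_le_one)
      also have "\<dots> \<le> C" unfolding C_def by (rule member_le_sum) (auto intro!: sum_nonneg)
      finally show ?thesis .
    qed
    have "\<exists>(v :: real ^ 's) a. (\<forall>s. a s \<in> {0..1}) \<and>
        (\<forall>s. \<forall>b\<in>{0..1}. h s b + \<beta> * (\<Sum>t\<in>UNIV. poly (p s t) b * v $ t) \<le> v $ s) \<and>
        (\<Sum>s\<in>UNIV. v $ s) \<le> (\<Sum>s\<in>UNIV. occ a s * h s (a s)) + \<epsilon>"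
      unfolding occ_def
      by (rule mdp_near_duality[where P = "\<lambda>s t. poly (p s t)", OF stochastic_pure \<beta> hC _ \<epsilon>]) auto
    then obtain v :: "real ^ 's" and a where a: "\<And>s. a s \<in> {0..1}"
      and v: "\<And>s b. b \<in> {0..1} \<Longrightarrow> h s b + \<beta> * (\<Sum>t\<in>UNIV. poly (p s t) b * v $ t) \<le> v $ s"
      and sum_v: "(\<Sum>s\<in>UNIV. v $ s) \<le> (\<Sum>s\<in>UNIV. occ a s * h s (a s)) + \<epsilon>"
      by blast
    have "0 \<le> poly (P_poly d m r p \<beta> v nb s) b" if "b \<in> {0..1}" for s b
      using v[OF that, of s] by (simp add: poly_P_poly h_def moment_payoff_def)
    moreover have "nb s \<in> moment_space (m s) {0..1}" for s
      unfolding moment_space_def using nb[of s] by blast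
    ultimately have "(v, nb) \<in> P_feasible d m r p \<beta>"
      using nb0 unfolding P_feasible_def nonneg_polys_def by blast
    moreover have "P_objective (v, nb) \<le> c + \<epsilon>"
    proof -
      have "(\<Sum>s\<in>UNIV. occ a s * h s (a s)) - c = measure_pmf.expectation w (g a)"
        unfolding g_def h by (simp add: intw)
      also have "\<dots> \<le> 0" using a by (intro col(2)) (simp add: A_def)
      finally show ?thesis using sum_v by (simp add: P_objective_def)
    qed
    ultimately show ?thesis by blast
  qed
qed

text \<open>
  If the values differed, the alternative at the midpoint of an interval strictly between them
  would produce a feasible point on the wrong side of one of them.
\<close>

lemma strong_duality: "P_value d m r p \<beta> = D_value d m r p \<beta>"
proof (rule order_antisym)
  show "D_value d m r p \<beta> \<le> P_value d m r p \<beta>"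
    unfolding D_value_def P_value_def
    using weak_duality[OF game]
    by (intro SUP_least INF_greatest) (auto simp: P_objective_def D_objective_def)
  show "P_value d m r p \<beta> \<le> D_value d m r p \<beta>"
  proof (rule ccontr)
    assume "\<not> ?thesis"
    then obtain l where l: "D_value d m r p \<beta> < ereal l" "ereal l < P_value d m r p \<beta>"
      using ereal_dense2 by (metis not_le)
    obtain u where u: "ereal l < ereal u" "ereal u < P_value d m r p \<beta>"
      using ereal_dense2[OF l(2)] by blast
    have "0 < (u - l) / 2" using u(1) by simp
    from duality_alternative[OF this, of "(u + l) / 2"] show False
    proof (elim disjE bexE)
      fix x assume x: "x \<in> P_feasible d m r p \<beta>" "P_objective x \<le> (u + l) / 2 + (u - l) / 2"
      have "P_value d m r p \<beta> \<le> ereal (P_objective x)"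
        unfolding P_value_def by (rule INF_lower[OF x(1)])
      also have "\<dots> \<le> ereal u" using x(2) by (simp add: field_simps)
      finally show False using u(2) by simp
    next
      fix y assume y: "y \<in> D_feasible d m r p \<beta>" "(u + l) / 2 - (u - l) / 2 \<le> D_objective y"
      have "ereal l \<le> ereal (D_objective y)" using y(2) by (simp add: field_simps)
      also have "\<dots> \<le> D_value d m r p \<beta>"
        unfolding D_value_def by (rule SUP_upper[OF y(1)])
      finally show False using l(1) by simp
    qed
  qed
qed

end


section \<open>Equilibria from optimal solutions\<close>

lemma P_optimal_value:
  assumes "P_optimal d m r p \<beta> x"
  shows "x \<in> P_feasible d m r p \<beta>" "P_value d m r p \<beta> = ereal (P_objective x)"
  using assms unfolding P_optimal_def is_arg_min_linorder P_value_def
  by (auto intro!: antisym INF_lower INF_greatest)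

lemma D_optimal_value:
  assumes "D_optimal d m r p \<beta> x"
  shows "x \<in> D_feasible d m r p \<beta>" "D_value d m r p \<beta> = ereal (D_objective x)"
  using assms unfolding D_optimal_def is_arg_max_linorder D_value_def
  by (auto intro!: antisym SUP_upper SUP_least)

lemma mixed_strategy_moment_vec:
  assumes "mixed_strategy {0..1} \<mu>"
  shows "has_moment_vec {0..1} n (\<mu> s) (restrict (moment (\<mu> s)) {..n})"
  using assms unfolding mixed_strategy_def
  by (intro has_moment_vec_unit_interval prob_space.finite_measure) auto

lemma mixed_strategy_moment_0:
  assumes "mixed_strategy A \<mu>"
  shows "moment (\<mu> s) 0 = 1"
  using assms unfolding mixed_strategy_def by (simp add: moment_0 prob_space.prob_space)

lemma payoff_vec_moments:
  assumes \<mu>: "\<And>s. has_moment_vec A (d s) (\<mu> s) (x s)" and \<nu>: "\<And>s. has_moment_vec A' (m s) (\<nu> s) (y s)"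
  shows "payoff_vec d m r \<mu> \<nu> $ s = moment_payoff d m r s (x s) (y s)"
proof -
  have "payoff_vec d m r \<mu> \<nu> $ s = (LINT a|\<mu> s. moment_payoff d m r s (\<lambda>i. a ^ i) (y s))"
    unfolding payoff_vec_def payoff_eq_moment_payoff
    by (simp add: integral_moment_payoff_columns[where m = m and s = s, OF \<nu>])
  also have "\<dots> = moment_payoff d m r s (x s) (y s)"
    by (rule integral_moment_payoff_rows(2)[where d = d and s = s, OF \<mu>])
  finally show ?thesis .
qed

context
  fixes d m :: "'s::finite \<Rightarrow> nat" and r :: "'s \<Rightarrow> nat \<Rightarrow> nat \<Rightarrow> real"
    and p :: "'s \<Rightarrow> 's \<Rightarrow> real poly" and \<beta> :: real
  assumes game: "single_controller_game d p \<beta>"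
begin

lemma trans_matrix_moments:
  assumes \<mu>: "\<And>s. has_moment_vec A (d s) (\<mu> s) (x s)"
  shows "trans_matrix p \<mu> $ s $ t = moment_trans d p s t (x s)"
  unfolding trans_matrix_def by (simp add: integral_trans[OF game \<mu>])

lemma stochastic_trans_matrix:
  assumes "mixed_strategy {0..1} \<mu>"
  shows "stochastic_matrix (trans_matrix p \<mu>)"
proof -
  define x where "x s = restrict (moment (\<mu> s)) {..d s}" for s
  have \<mu>: "has_moment_vec {0..1} (d s) (\<mu> s) (x s)" for s
    unfolding x_def by (rule mixed_strategy_moment_vec[OF assms])
  then have ms: "x s \<in> moment_space (d s) {0..1}" for s by (auto simp: moment_space_def)
  have "x s 0 = 1" for s using mixed_strategy_moment_0[OF assms] by (simp add: x_def)
  then show ?thesis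
    unfolding stochastic_matrix_def trans_matrix_moments[OF \<mu>]
    using moment_trans_nonneg[OF game ms] sum_moment_trans[OF game ms] by simp
qed

lemma v_disc_mult:
  assumes "mixed_strategy {0..1} \<mu>"
  shows "(mat 1 - \<beta> *\<^sub>R trans_matrix p \<mu>) *v v_disc d m r p \<beta> \<mu> \<nu> = payoff_vec d m r \<mu> \<nu>"
  unfolding v_disc_def
  by (rule discounted_resolvent_right[OF stochastic_trans_matrix[OF assms] discount[OF game]])

lemma discounted_trans_mono:
  assumes "mixed_strategy {0..1} \<mu>"
    and "(mat 1 - \<beta> *\<^sub>R trans_matrix p \<mu>) *v x \<le> (mat 1 - \<beta> *\<^sub>R trans_matrix p \<mu>) *v y"
  shows "x \<le> y"
  using discounted_mono[OF stochastic_trans_matrix[OF assms(1)] discount[OF game] assms(2)] .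

text \<open>
  By complementary slackness, dividing the moments of \<open>\<xi>'\<close> by their mass makes the Bellman
  inequality an equation under \<open>\<mu>'\<close>.  Deviations of player 1 are controlled by the constraints of
  \<open>P'\<close>, those of player 2 by the constraints of \<open>D'\<close>; in both cases the two sides are compared
  after applying \<open>I - \<beta> P\<close>, with \<open>P\<close> the transition matrix of the strategy of player 1.
\<close>

lemma optimal_solutions_saddle_point:
  assumes P: "(v, nb) \<in> P_feasible d m r p \<beta>" and D: "(\<alpha>, xb) \<in> D_feasible d m r p \<beta>"
    and eq: "(\<Sum>s\<in>UNIV. v $ s) = (\<Sum>s\<in>UNIV. \<alpha> $ s)"
    and \<nu>: "\<And>s. has_moment_vec {0..1} (m s) (\<nu>' s) (nb s)"
    and \<xi>: "\<And>s. has_moment_vec {0..1} (d s) (\<xi>' s) (xb s)"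
    and \<mu>': "\<And>s. \<mu>' s = normalize_measure (\<xi>' s)"
  shows "v = v_disc d m r p \<beta> \<mu>' \<nu>'"
    and "mixed_strategy {0..1} \<mu> \<Longrightarrow> v_disc d m r p \<beta> \<mu> \<nu>' \<le> v"
    and "mixed_strategy {0..1} \<nu> \<Longrightarrow> v \<le> v_disc d m r p \<beta> \<mu>' \<nu>"
proof -
  note slack = complementary_slackness[OF game P D eq]
  have mass: "1 \<le> xb s 0" for s by (rule D_feasible_mass[OF game D])
  have fin: "finite_measure (\<xi>' s)" for s using \<xi> by (simp add: has_moment_vec_def)
  have pos: "0 < measure (\<xi>' s) (space (\<xi>' s))" for s
    using mass[of s] by (simp add: moment_vec_0[OF \<xi>])
  have mixed: "mixed_strategy {0..1} \<mu>'"
    using \<xi> prob_space_normalize_measure[OF fin pos] sets_normalize_measure[OF fin pos]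
    by (simp add: mixed_strategy_def \<mu>' has_moment_vec_def)
  define x where "x s = restrict (moment (\<mu>' s)) {..d s}" for s
  have x: "has_moment_vec {0..1} (d s) (\<mu>' s) (x s)" for s
    unfolding x_def by (rule mixed_strategy_moment_vec[OF mixed])
  have x_eq: "x s i = xb s i / xb s 0" if "i \<le> d s" for s i
  proof -
    have "integrable (\<xi>' s) (\<lambda>a. a ^ i)" and xbi: "xb s i = moment (\<xi>' s) i"
      using \<xi>[of s] that by (auto simp: has_moment_vec_def)
    then have "moment (\<mu>' s) i = moment (\<xi>' s) i / measure (\<xi>' s) (space (\<xi>' s))"
      unfolding moment_def \<mu>' by (intro integral_normalize_measure[OF fin pos]) auto
    with that xbi show ?thesis by (simp add: x_def moment_vec_0[OF \<xi>])
  qed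
  have payoff_x: "moment_payoff d m r s (x s) y = moment_payoff d m r s (xb s) y / xb s 0" for s y
    by (simp add: moment_payoff_def x_eq sum_divide_distrib)
  have trans_x: "moment_trans d p s t (x s) = moment_trans d p s t (xb s) / xb s 0" for s t
    by (simp add: moment_trans_def x_eq sum_divide_distrib)
  have bellman: "((mat 1 - \<beta> *\<^sub>R trans_matrix p \<mu>') *v v) $ s = \<alpha> $ s / xb s 0" for s
  proof -
    have "(\<Sum>t\<in>UNIV. moment_trans d p s t (x s) * v $ t) =
        (\<Sum>t\<in>UNIV. moment_trans d p s t (xb s) * v $ t) / xb s 0"
      by (simp add: trans_x sum_divide_distrib)
    then have "((mat 1 - \<beta> *\<^sub>R trans_matrix p \<mu>') *v v) $ s =
        v $ s - \<beta> * ((\<Sum>t\<in>UNIV. moment_trans d p s t (xb s) * v $ t) / xb s 0)"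
      unfolding discounted_mult_nth trans_matrix_moments[OF x] by simp
    also have "\<dots> = \<alpha> $ s / xb s 0"
      unfolding slack using mass[of s] by (simp add: diff_divide_distrib)
    finally show ?thesis .
  qed
  have "(mat 1 - \<beta> *\<^sub>R trans_matrix p \<mu>') *v v = payoff_vec d m r \<mu>' \<nu>'"
    unfolding vec_eq_iff bellman payoff_vec_moments[where d = d and m = m, OF x \<nu>] payoff_x
    using slack(1) by simp
  then show v: "v = v_disc d m r p \<beta> \<mu>' \<nu>'"
    unfolding v_disc_def
    using discounted_resolvent_left[OF stochastic_trans_matrix[OF mixed] discount[OF game], of v]
    by (simp only:)
  show "v_disc d m r p \<beta> \<mu> \<nu>' \<le> v" if \<mu>: "mixed_strategy {0..1} \<mu>"
  proof (rule discounted_trans_mono[OF \<mu>])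
    define z where "z s = restrict (moment (\<mu> s)) {..d s}" for s
    have z: "has_moment_vec {0..1} (d s) (\<mu> s) (z s)" for s
      unfolding z_def by (rule mixed_strategy_moment_vec[OF \<mu>])
    have z0: "z s 0 = 1" for s using mixed_strategy_moment_0[OF \<mu>] by (simp add: z_def)
    have "z s \<in> moment_space (d s) {0..1}" for s using z by (auto simp: moment_space_def)
    from P_feasible_moment_ineq[OF game P this]
    show "(mat 1 - \<beta> *\<^sub>R trans_matrix p \<mu>) *v v_disc d m r p \<beta> \<mu> \<nu>' \<le>
        (mat 1 - \<beta> *\<^sub>R trans_matrix p \<mu>) *v v"
      unfolding v_disc_mult[OF \<mu>] less_eq_vec_def discounted_mult_nth trans_matrix_moments[OF z]
        payoff_vec_moments[where d = d and m = m, OF z \<nu>] by (simp add: z0)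
  qed
  show "v \<le> v_disc d m r p \<beta> \<mu>' \<nu>" if \<nu>: "mixed_strategy {0..1} \<nu>"
  proof (rule discounted_trans_mono[OF mixed])
    define z where "z s = restrict (moment (\<nu> s)) {..m s}" for s
    have z: "has_moment_vec {0..1} (m s) (\<nu> s) (z s)" for s
      unfolding z_def by (rule mixed_strategy_moment_vec[OF \<nu>])
    have z0: "z s 0 = 1" for s using mixed_strategy_moment_0[OF \<nu>] by (simp add: z_def)
    have "z s \<in> moment_space (m s) {0..1}" for s using z by (auto simp: moment_space_def)
    from D_feasible_moment_ineq[OF game D this]
    have "\<alpha> $ s / xb s 0 \<le> moment_payoff d m r s (xb s) (z s) / xb s 0" for s
      using mass[of s] by (intro divide_right_mono) (simp_all add: z0)
    then show "(mat 1 - \<beta> *\<^sub>R trans_matrix p \<mu>') *v v \<le>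
        (mat 1 - \<beta> *\<^sub>R trans_matrix p \<mu>') *v v_disc d m r p \<beta> \<mu>' \<nu>"
      unfolding v_disc_mult[OF mixed] less_eq_vec_def bellman
        payoff_vec_moments[where d = d and m = m, OF x z] payoff_x by blast
  qed
qed

end

theorem theorem3:
  fixes d m :: "'s::finite \<Rightarrow> nat"
    and r :: "'s \<Rightarrow> nat \<Rightarrow> nat \<Rightarrow> real"
    and p :: "'s \<Rightarrow> 's \<Rightarrow> real poly"
    and \<beta> :: real
  assumes "single_controller_game d p \<beta>"
  shows "P_value d m r p \<beta> = D_value d m r p \<beta> \<and>
    (\<forall>(v :: real ^ 's) (nb :: 's \<Rightarrow> nat \<Rightarrow> real) (\<alpha> :: real ^ 's) (xb :: 's \<Rightarrow> nat \<Rightarrow> real)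
        (\<nu>' :: 's \<Rightarrow> real measure) (\<xi>' :: 's \<Rightarrow> real measure) (\<mu>' :: 's \<Rightarrow> real measure).
      P_optimal d m r p \<beta> (v, nb) \<longrightarrow>
      D_optimal d m r p \<beta> (\<alpha>, xb) \<longrightarrow>
      (\<forall>s. has_moment_vec A2 (m s) (\<nu>' s) (nb s)) \<longrightarrow>
      (\<forall>s. has_moment_vec A1 (d s) (\<xi>' s) (xb s)) \<longrightarrow>
      (\<forall>s. \<mu>' s = normalize_measure (\<xi>' s)) \<longrightarrow>
      v = v_disc d m r p \<beta> \<mu>' \<nu>' \<and>
      (\<forall>\<mu> \<nu>. mixed_strategy A1 \<mu> \<longrightarrow> mixed_strategy A2 \<nu> \<longrightarrow>
         v_disc d m r p \<beta> \<mu> \<nu>' \<le> v_disc d m r p \<beta> \<mu>' \<nu>' \<and>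
         v_disc d m r p \<beta> \<mu>' \<nu>' \<le> v_disc d m r p \<beta> \<mu>' \<nu>))"
proof (intro conjI allI impI)
  show duality: "P_value d m r p \<beta> = D_value d m r p \<beta>" by (rule strong_duality[OF assms])
  fix v :: "real ^ 's" and nb :: "'s \<Rightarrow> nat \<Rightarrow> real" and \<alpha> :: "real ^ 's" and xb :: "'s \<Rightarrow> nat \<Rightarrow> real"
    and \<nu>' \<xi>' \<mu>' :: "'s \<Rightarrow> real measure"
  assume P: "P_optimal d m r p \<beta> (v, nb)" and D: "D_optimal d m r p \<beta> (\<alpha>, xb)"
    and meas: "\<forall>s. has_moment_vec A2 (m s) (\<nu>' s) (nb s)"
      "\<forall>s. has_moment_vec A1 (d s) (\<xi>' s) (xb s)" "\<forall>s. \<mu>' s = normalize_measure (\<xi>' s)"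
  have "(\<Sum>s\<in>UNIV. v $ s) = (\<Sum>s\<in>UNIV. \<alpha> $ s)"
    using duality P_optimal_value(2)[OF P] D_optimal_value(2)[OF D]
    by (simp add: P_objective_def D_objective_def)
  note saddle = optimal_solutions_saddle_point[OF assms P_optimal_value(1)[OF P] D_optimal_value(1)[OF D]
    this spec[OF meas(1)] spec[OF meas(2)] spec[OF meas(3)]]
  show "v = v_disc d m r p \<beta> \<mu>' \<nu>'" by (rule saddle(1))
  fix \<mu> \<nu> :: "'s \<Rightarrow> real measure"
  assume \<mu>: "mixed_strategy A1 \<mu>" and \<nu>: "mixed_strategy A2 \<nu>"
  show "v_disc d m r p \<beta> \<mu> \<nu>' \<le> v_disc d m r p \<beta> \<mu>' \<nu>'"
    unfolding saddle(1)[symmetric] by (rule saddle(2)[OF \<mu>])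
  show "v_disc d m r p \<beta> \<mu>' \<nu>' \<le> v_disc d m r p \<beta> \<mu>' \<nu>"
    unfolding saddle(1)[symmetric] by (rule saddle(3)[OF \<nu>])
qed

end
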